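(* Let $m=(m_0,\dots,m_s)$ be a vector of odd integers $\ge3$, $G=\bigoplus_\ell\mathbb Z_{m_\ell}$, $|m|=\prod_\ell m_\ell$, and let $\mathcal B$ be the binder of $\mathcal G(m)$. There exists at least one subset $\mathcal A\subset\mathcal B$ which is a partition of $G\times G$. For any such $\mathcal A$ and $\beta\ne\beta'$ in $\mathcal A$, $\mathrm{tr}(P_\beta P_{\beta'})=1$, where $P_\beta$ is the orthogonal projection onto the span of $\{\pi(k,\kappa)\psi\}_{(k,\kappa)\in\beta}$. Consequently the states $W_\beta=P_\beta/\mathrm{tr}(P_\beta)$, $\beta\in\mathcal A$, form an $|m|$-element arrangement of trace-one positive semidefinite operators on $\mathbb C^{|m|(|m|-1)/2}$ of purity $\mathrm{tr}(W_\beta^2)=1/(|m|-1)$ with $\mathrm{tr}(W_\beta W_{\beta'})=\frac{n-\gamma d}{(n-1)d}$ for all $\beta\ne\beta'$, where $n=|m|$, $d=|m|(|m|-1)/2$, $\gamma=1/(|m|-1)$ (saturation of the first Rankin bound); i.e. an equichordal arrangement of $|m|$ subspaces of dimension $|m|-1$ of $\mathbb C^{|m|(|m|-1)/2}$.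
   Context: Elements of $G$ ordered lexicographically; $\mathbb C^{|m|}$ has basis $\{e_j\}_{j\in G}$. Fixed primitive $m_\ell$-th roots of unity $\zeta_{m_\ell}$; $T^{(k)}e_j=e_{j+k}$, $M^{(\kappa)}e_j=\prod_\ell\zeta_{m_\ell}^{\kappa_\ell j_\ell}e_j$. Let $c=((m_0-1)/2,\dots,(m_s-1)/2)$, $\mathcal I=\{i\in G:i<_{\mathrm{lex}}c\}$, $\phi_i=e_i-e_{-i-\mathbb 1}$ with $-i-\mathbb 1=(m_0-i_0-1,\dots,m_s-i_s-1)$; $\psi$ is the concatenation of the $\phi_i$, $i\in\mathcal I$, in lexicographic order; $\pi(k,\kappa)=I_{(|m|-1)/2}\otimes(M^{(\kappa)}T^{(k)})$; $\mathcal G(m)=\{\pi(k,\kappa)\psi\}_{(k,\kappa)\in G\times G}$, an equiangular tight frame (ETF) for $\mathbb C^{|m|(|m|-1)/2}$. Switching equivalence: $\Psi=U\Phi PD$, $U$ unitary, $P$ permutation, $D$ unimodular diagonal. A simplex is an index set $\beta$ with $\{\varphi_j\}_{j\in\beta}$ switching equivalent to an ETF for a space of dimension $|\beta|-1$ with all pairwise inner products real and negative; the binder is the set of all simplices. Purity of a state $W$ is $\mathrm{tr}(W^2)$. *)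

theory Defs
  imports
    "HOL-Library.Disjoint_Sets"
    "HOL-Combinatorics.Permutations"
    "Jordan_Normal_Form.Schur_Decomposition"
begin

abbreviation Cspace :: "nat \<Rightarrow> (complex, complex vec) module"
  where "Cspace d \<equiv> module_vec TYPE(complex) d"

definition lspan :: "nat \<Rightarrow> complex vec set \<Rightarrow> complex vec set"
  where "lspan d X = LinearCombinations.module.span class_ring (Cspace d) X"

definition lsubspace :: "nat \<Rightarrow> complex vec set \<Rightarrow> bool"
  where "lsubspace d S \<longleftrightarrow> VectorSpace.subspace class_ring S (Cspace d)"

definition ldim :: "nat \<Rightarrow> complex vec set \<Rightarrow> nat"
  where "ldim d S = vectorspace.dim class_ring (Cspace d\<lparr>carrier := S\<rparr>)"

definition trace :: "complex mat \<Rightarrow> complex"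
  where "trace A = (\<Sum>i<dim_row A. A $$ (i, i))"

definition unitary :: "nat \<Rightarrow> complex mat \<Rightarrow> bool"
  where "unitary d U \<longleftrightarrow> U \<in> carrier_mat d d \<and> U * mat_adjoint U = 1\<^sub>m d \<and> mat_adjoint U * U = 1\<^sub>m d"

definition pos_semidef :: "nat \<Rightarrow> complex mat \<Rightarrow> bool"
  where "pos_semidef d A \<longleftrightarrow> A \<in> carrier_mat d d \<and> mat_adjoint A = A
    \<and> (\<forall>v\<in>carrier_vec d. 0 \<le> Re ((A *\<^sub>v v) \<bullet>c v))"

definition kron :: "complex mat \<Rightarrow> complex mat \<Rightarrow> complex mat"
  where "kron A B = mat (dim_row A * dim_row B) (dim_col A * dim_col B)
    (\<lambda>(i, j). A $$ (i div dim_row B, j div dim_col B) * B $$ (i mod dim_row B, j mod dim_col B))"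

definition orth_proj :: "nat \<Rightarrow> complex vec set \<Rightarrow> complex mat"
  where "orth_proj d S = (THE P. P \<in> carrier_mat d d \<and>
    (\<forall>v\<in>carrier_vec d. P *\<^sub>v v \<in> S \<and> (\<forall>s\<in>S. (v - P *\<^sub>v v) \<bullet>c s = 0)))"

text \<open>The chordal distance of two subspaces is the Hilbert-Schmidt distance of their orthogonal
  projections divided by the square root of 2; for subspaces of dimension k with projections P, Q its
  square is k - tr(PQ).\<close>

definition chordal_dist :: "nat \<Rightarrow> complex vec set \<Rightarrow> complex vec set \<Rightarrow> real"
  where "chordal_dist d S S' =
    (let D = orth_proj d S - orth_proj d S' in sqrt (Re (trace (D * mat_adjoint D)) / 2))"

definition equichordal :: "nat \<Rightarrow> nat \<Rightarrow> complex vec set set \<Rightarrow> bool"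
  where "equichordal d k \<V> \<longleftrightarrow> (\<forall>S\<in>\<V>. lsubspace d S \<and> ldim d S = k)
    \<and> (\<exists>c. \<forall>S\<in>\<V>. \<forall>S'\<in>\<V>. S \<noteq> S' \<longrightarrow> chordal_dist d S S' = c)"

text \<open>Frames are families indexed by a set. They are equal-norm but not necessarily unit-norm: the
  vectors of the frame studied here have squared norm |m| - 1.\<close>

definition etf :: "nat \<Rightarrow> complex vec set \<Rightarrow> 'j set \<Rightarrow> ('j \<Rightarrow> complex vec) \<Rightarrow> bool"
  where "etf d S J f \<longleftrightarrow> lsubspace d S \<and> finite J \<and> f ` J \<subseteq> S
    \<and> (\<exists>r::real. \<forall>j\<in>J. f j \<bullet>c f j = of_real r)
    \<and> (\<exists>\<alpha>. \<forall>i\<in>J. \<forall>j\<in>J. i \<noteq> j \<longrightarrow> cmod (f i \<bullet>c f j) = \<alpha>)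
    \<and> (\<exists>A>0. \<forall>x\<in>S. (\<Sum>j\<in>J. (cmod (x \<bullet>c f j))\<^sup>2) = A * Re (x \<bullet>c x))"

text \<open>Column by column, this is \<open>\<Psi> = U \<Phi> P D\<close> with U unitary, P the permutation matrix of
  \<open>\<sigma>\<close> and D the diagonal matrix with entries z j.\<close>

definition switching_equiv ::
    "nat \<Rightarrow> 'j set \<Rightarrow> ('j \<Rightarrow> complex vec) \<Rightarrow> ('j \<Rightarrow> complex vec) \<Rightarrow> bool"
  where "switching_equiv d J \<Phi> \<Psi> \<longleftrightarrow>
    (\<exists>U \<sigma> z. unitary d U \<and> \<sigma> permutes J \<and> (\<forall>j\<in>J. cmod (z j) = 1)
      \<and> (\<forall>j\<in>J. \<Psi> j = z j \<cdot>\<^sub>v (U *\<^sub>v \<Phi> (\<sigma> j))))"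

text \<open>The dimension condition is stated as card \<open>\<beta>\<close> = dim + 1 because subtraction on the natural
  numbers truncates.\<close>

definition simplex :: "nat \<Rightarrow> ('j \<Rightarrow> complex vec) \<Rightarrow> 'j set \<Rightarrow> bool"
  where "simplex d \<Phi> \<beta> \<longleftrightarrow> finite \<beta> \<and>
    (\<exists>\<Psi> S. switching_equiv d \<beta> \<Phi> \<Psi> \<and> etf d S \<beta> \<Psi> \<and> card \<beta> = ldim d S + 1
      \<and> (\<forall>i\<in>\<beta>. \<forall>j\<in>\<beta>. i \<noteq> j \<longrightarrow> \<Psi> i \<bullet>c \<Psi> j \<in> \<real> \<and> Re (\<Psi> i \<bullet>c \<Psi> j) < 0))"

definition frame_binder :: "nat \<Rightarrow> 'j set \<Rightarrow> ('j \<Rightarrow> complex vec) \<Rightarrow> 'j set set"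
  where "frame_binder d J \<Phi> = {\<beta>. \<beta> \<subseteq> J \<and> simplex d \<Phi> \<beta>}"

text \<open>The vector m is a list, and an element of G, the direct sum of the cyclic groups
  of orders m ! l, is the list of its coordinates, represented in {0..<m ! l}.\<close>

definition grp :: "nat list \<Rightarrow> nat list set"
  where "grp m = {j. length j = length m \<and> (\<forall>l<length m. j ! l < m ! l)}"

definition grp_add :: "nat list \<Rightarrow> nat list \<Rightarrow> nat list \<Rightarrow> nat list"
  where "grp_add m j k = map (\<lambda>l. (j ! l + k ! l) mod m ! l) [0..<length m]"

definition lex_less :: "nat list \<Rightarrow> nat list \<Rightarrow> bool"
  where "lex_less i j \<longleftrightarrow> (i, j) \<in> lex less_than"

definition grp_list :: "nat list \<Rightarrow> nat list list"
  where "grp_list m = product_lists (map (\<lambda>n. [0..<n]) m)"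

lemma set_grp_list: "set (grp_list m) = grp m"
  by (auto simp: grp_list_def grp_def product_lists_set list_all2_conv_all_nth)

lemma length_grp_list: "length (grp_list m) = prod_list m"
  unfolding grp_list_def by (induction m) (simp_all add: length_concat o_def sum_list_triv)

lemma lex_less_Cons:
  "lex_less (a # i) (b # j) \<longleftrightarrow> a < b \<and> length i = length j \<or> a = b \<and> lex_less i j"
  by (auto simp: lex_less_def)

lemma sorted_concat_lex:
  assumes "sorted_wrt lex_less X" "sorted_wrt (<) ns" "\<forall>x\<in>set X. length x = l"
  shows "sorted_wrt lex_less (concat (map (\<lambda>n. map (Cons n) X) ns))"
  using assms(2)
proof (induction ns)
  case (Cons n ns)
  have "sorted_wrt lex_less (map (Cons n) X)"
    using assms(1) by (simp add: sorted_wrt_map lex_less_Cons)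
  then show ?case
    using Cons assms(3) by (auto simp: sorted_wrt_append lex_less_Cons)
qed simp

lemma sorted_grp_list: "sorted_wrt lex_less (grp_list m)"
proof (induction m)
  case (Cons n m)
  have "\<forall>x\<in>set (grp_list m). length x = length m"
    by (simp add: set_grp_list grp_def)
  with Cons.IH show ?case
    using sorted_concat_lex[of "grp_list m" "[0..<n]" "length m"]
    by (simp add: grp_list_def)
qed (simp add: grp_list_def)

definition basis_vec :: "nat list \<Rightarrow> nat list \<Rightarrow> complex vec"
  where "basis_vec m j = vec (prod_list m) (\<lambda>a. if grp_list m ! a = j then 1 else 0)"

definition primitive_unity_root :: "nat \<Rightarrow> complex \<Rightarrow> bool"
  where "primitive_unity_root n z \<longleftrightarrow> z ^ n = 1 \<and> (\<forall>k. 0 < k \<and> k < n \<longrightarrow> z ^ k \<noteq> 1)"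

definition transl_op :: "nat list \<Rightarrow> nat list \<Rightarrow> complex mat"
  where "transl_op m k = mat_of_cols (prod_list m)
    (map (\<lambda>j. basis_vec m (grp_add m j k)) (grp_list m))"

definition modul_op :: "nat list \<Rightarrow> (nat \<Rightarrow> complex) \<Rightarrow> nat list \<Rightarrow> complex mat"
  where "modul_op m \<zeta> \<kappa> = mat_of_cols (prod_list m)
    (map (\<lambda>j. (\<Prod>l<length m. \<zeta> l ^ (\<kappa> ! l * j ! l)) \<cdot>\<^sub>v basis_vec m j) (grp_list m))"

definition gs_pi :: "nat list \<Rightarrow> (nat \<Rightarrow> complex) \<Rightarrow> nat list \<Rightarrow> nat list \<Rightarrow> complex mat"
  where "gs_pi m \<zeta> k \<kappa> = kron (1\<^sub>m ((prod_list m - 1) div 2)) (modul_op m \<zeta> \<kappa> * transl_op m k)"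

definition gs_dim :: "nat list \<Rightarrow> nat"
  where "gs_dim m = prod_list m * (prod_list m - 1) div 2"

definition center :: "nat list \<Rightarrow> nat list"
  where "center m = map (\<lambda>n. (n - 1) div 2) m"

definition reflect :: "nat list \<Rightarrow> nat list \<Rightarrow> nat list"
  where "reflect m i = map (\<lambda>l. m ! l - i ! l - 1) [0..<length m]"

definition phi :: "nat list \<Rightarrow> nat list \<Rightarrow> complex vec"
  where "phi m i = basis_vec m i - basis_vec m (reflect m i)"

definition psi :: "nat list \<Rightarrow> complex vec"
  where "psi m = vec_of_list (concat
    (map (\<lambda>i. list_of_vec (phi m i)) (filter (\<lambda>i. lex_less i (center m)) (grp_list m))))"

definition gs_frame :: "nat list \<Rightarrow> (nat \<Rightarrow> complex) \<Rightarrow> nat list \<times> nat list \<Rightarrow> complex vec"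
  where "gs_frame m \<zeta> = (\<lambda>(k, \<kappa>). gs_pi m \<zeta> k \<kappa> *\<^sub>v psi m)"

definition gs_binder :: "nat list \<Rightarrow> (nat \<Rightarrow> complex) \<Rightarrow> (nat list \<times> nat list) set set"
  where "gs_binder m \<zeta> = frame_binder (gs_dim m) (grp m \<times> grp m) (gs_frame m \<zeta>)"

definition gs_space ::
    "nat list \<Rightarrow> (nat \<Rightarrow> complex) \<Rightarrow> (nat list \<times> nat list) set \<Rightarrow> complex vec set"
  where "gs_space m \<zeta> \<beta> = lspan (gs_dim m) (gs_frame m \<zeta> ` \<beta>)"

definition gs_proj ::
    "nat list \<Rightarrow> (nat \<Rightarrow> complex) \<Rightarrow> (nat list \<times> nat list) set \<Rightarrow> complex mat"
  where "gs_proj m \<zeta> \<beta> = orth_proj (gs_dim m) (gs_space m \<zeta> \<beta>)"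

definition gs_state ::
    "nat list \<Rightarrow> (nat \<Rightarrow> complex) \<Rightarrow> (nat list \<times> nat list) set \<Rightarrow> complex mat"
  where "gs_state m \<zeta> \<beta> = (1 / trace (gs_proj m \<zeta> \<beta>)) \<cdot>\<^sub>m gs_proj m \<zeta> \<beta>"

end

theory Submission
  imports Defs
begin

text \<open>Writing \<open>\<chi>\<^sub>\<kappa>\<close> for the characters of G, the Gram matrix of the frame is
  \<open>N [\<lambda> = \<mu>] - \<chi>\<^sub>\<kappa>(a) cnj (\<chi>\<^sub>\<kappa>'(a))\<close> at \<open>\<lambda> = (k, \<kappa>)\<close>, \<open>\<mu> = (k', \<kappa>')\<close>, where N = |m| and a is the unique
  solution of \<open>2a + 1 = k + k'\<close> in G. Along a simplex, switching turns the Gram matrix into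
  \<open>N I - J\<close>; this matrix is invertible unless the simplex has N elements, while the vectors of a
  simplex are linearly dependent. So every simplex has N elements and Gram matrix
  \<open>N I - w w\<^sup>*\<close> with w unimodular, and \<open>(1/N) \<Sum> f\<^sub>j f\<^sub>j\<^sup>*\<close> is the orthogonal projection onto its span. For two
  disjoint simplices the trace of the product is therefore \<open>N\<^sup>-\<^sup>2\<close> times the sum of the \<open>N\<^sup>2\<close> squared moduli
  of cross inner products, all equal to 1. A partition exists because for fixed k the point a
  does not depend on \<open>\<kappa>\<close>, \<open>\<kappa>'\<close>, so that \<open>{k} \<times> G\<close> is a simplex.\<close>

subsection \<open>Subspaces and orthogonal projections\<close>

lemma cscalar_prod_sum:
  fixes v w :: "complex vec"
  assumes "w \<in> carrier_vec d"
  shows "v \<bullet>c w = (\<Sum>r<d. v $ r * cnj (w $ r))"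
  using assms by (auto simp: scalar_prod_def lessThan_atLeast0 intro!: sum.cong)

lemma cscalar_prod_diff_left:
  fixes x y s :: "complex vec"
  assumes "x \<in> carrier_vec d" "y \<in> carrier_vec d" "s \<in> carrier_vec d"
  shows "(x - y) \<bullet>c s = x \<bullet>c s - y \<bullet>c s"
  using assms by (simp add: minus_scalar_prod_distrib)

lemma cscalar_prod_commute:
  fixes x y :: "complex vec"
  assumes "x \<in> carrier_vec d" "y \<in> carrier_vec d"
  shows "x \<bullet>c y = cnj (y \<bullet>c x)"
  by (simp add: cscalar_prod_sum[OF assms(1)] cscalar_prod_sum[OF assms(2)] mult.commute)

lemma cscalar_prod_diff_right:
  fixes x y s :: "complex vec"
  assumes "x \<in> carrier_vec d" "y \<in> carrier_vec d" "s \<in> carrier_vec d"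
  shows "s \<bullet>c (x - y) = s \<bullet>c x - s \<bullet>c y"
  using cscalar_prod_diff_left[OF assms] assms
  by (simp add: cscalar_prod_commute[of s d])

text \<open>Linear dependence is a notion for sets of vectors, while the arguments below concern
  indexed families with coefficients \<open>a j\<close>; injectivity makes the two kinds of
  coefficients correspond.\<close>

lemma lin_indpt_image:
  fixes f :: "'j \<Rightarrow> complex vec"
  assumes "finite J" "inj_on f J" "f ` J \<subseteq> carrier_vec d"
    and indpt: "\<And>a. \<forall>r<d. (\<Sum>j\<in>J. a j * f j $ r) = 0 \<Longrightarrow> \<forall>j\<in>J. a j = 0"
  shows "\<not> LinearCombinations.module.lin_dep class_ring (Cspace d) (f ` J)"
proof -
  interpret vec_space "TYPE(complex)" d .
  show ?thesis
  proof (rule finite_lin_indpt2)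
    fix a assume "lincomb a (f ` J) = 0\<^sub>v d"
    then have "(\<Sum>x\<in>f ` J. a x * x $ r) = 0" if "r < d" for r
      using lincomb_index[OF that assms(3), of a] that by simp
    then have "\<forall>r<d. (\<Sum>j\<in>J. (a \<circ> f) j * f j $ r) = 0"
      using assms(2) by (simp add: sum.reindex)
    from indpt[OF this] show "\<forall>v\<in>f ` J. a v = 0" by simp
  qed (use assms in auto)
qed

text \<open>\<open>ldim\<close> is the dimension of S as a vector space of its own, so S must first
  be shown finite-dimensional. Independence means the same in S and in the ambient space.\<close>

lemma card_lin_indpt_le_ldim:
  assumes "lsubspace d S" "A \<subseteq> S" "\<not> LinearCombinations.module.lin_dep class_ring (Cspace d) A"
  shows "card A \<le> ldim d S"
proof -
  interpret vec_space "TYPE(complex)" d .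
  have S: "VectorSpace.subspace class_ring S V" using assms(1) by (simp add: lsubspace_def)
  then have sub: "submodule class_ring S V" and SV: "S \<subseteq> carrier_vec d"
    by (auto simp: VectorSpace.subspace_def submodule_def)
  interpret S: vectorspace class_ring "vs S" using S by (rule subspace_is_vs)
  have li: "S.lin_dep B \<longleftrightarrow> lin_dep B" if "B \<subseteq> S" for B
    using span_li_not_depend(2)[OF that sub] by simp
  have bound: "finite B \<and> card B \<le> d" if "B \<subseteq> S" "\<not> S.lin_dep B" for B
    using li_le_dim[OF fin_dim, of B] that li[of B] SV dim_is_n by auto
  \<comment> \<open>Independent subsets of S have at most d elements, so a maximal one exists; being
    maximal, it generates S.\<close>
  have "\<exists>B. finite B \<and> maximal B (\<lambda>T. T \<subseteq> carrier (vs S) \<and> \<not> S.lin_dep T)"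
    by (rule maximal_exists[where N = d and B = "{}"])
      (use bound S.finite_lin_indpt2 in auto)
  then obtain B where B: "finite B" "maximal B (\<lambda>T. T \<subseteq> carrier (vs S) \<and> \<not> S.lin_dep T)" by blast
  have "S.fin_dim"
    using S.max_li_is_gen[OF B(2)] B unfolding S.fin_dim_def maximal_def by blast
  then have "card A \<le> S.dim"
    using S.li_le_dim(2)[of A] assms li by simp
  then show ?thesis by (simp add: ldim_def)
qed

lemma ldim_lspan_lin_indpt:
  assumes "finite A" "A \<subseteq> carrier_vec d"
    and "\<not> LinearCombinations.module.lin_dep class_ring (Cspace d) A"
  shows "ldim d (lspan d A) = card A"
proof -
  interpret vec_space "TYPE(complex)" d .
  have S: "VectorSpace.subspace class_ring (span A) V"
    using span_is_subspace assms by simp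
  then have sub: "submodule class_ring (span A) V"
    by (simp add: VectorSpace.subspace_def)
  have AS: "A \<subseteq> span A" using assms in_own_span by simp
  interpret S: vectorspace class_ring "vs (span A)" using S by (rule subspace_is_vs)
  have "S.basis A"
    using span_li_not_depend[OF AS sub] assms(3) AS by (simp add: S.basis_def)
  then show ?thesis
    using S.dim_basis[OF assms(1)] by (simp add: ldim_def lspan_def)
qed

lemma lsubspace_lspan: "A \<subseteq> carrier_vec d \<Longrightarrow> lsubspace d (lspan d A)"
proof -
  interpret vec_space "TYPE(complex)" d .
  show "A \<subseteq> carrier_vec d \<Longrightarrow> ?thesis"
    using span_is_subspace by (simp add: lspan_def lsubspace_def)
qed

lemma lspan_minimal:
  assumes "lsubspace d S" "A \<subseteq> S"
  shows "lspan d A \<subseteq> S"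
proof -
  interpret vec_space "TYPE(complex)" d .
  show ?thesis using assms span_is_subset[of A S] by (simp add: lspan_def lsubspace_def VectorSpace.subspace_def)
qed

lemma subset_lspan:
  assumes "A \<subseteq> carrier_vec d"
  shows "A \<subseteq> lspan d A"
proof -
  interpret vec_space "TYPE(complex)" d .
  show ?thesis using assms in_own_span[of A] by (simp add: lspan_def)
qed

lemma lspan_carrier:
  assumes "A \<subseteq> carrier_vec d"
  shows "lspan d A \<subseteq> carrier_vec d"
proof -
  interpret vec_space "TYPE(complex)" d .
  show ?thesis using assms span_is_subset2[of A] by (simp add: lspan_def)
qed

lemma lsubspace_iff:
  "lsubspace d S \<longleftrightarrow> S \<subseteq> carrier_vec d \<and> 0\<^sub>v d \<in> S \<and>
     (\<forall>v\<in>S. \<forall>w\<in>S. v + w \<in> S) \<and> (\<forall>c. \<forall>v\<in>S. c \<cdot>\<^sub>v v \<in> S)"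
proof -
  interpret vec_space "TYPE(complex)" d .
  show ?thesis
    using vec_vs[where ?'a = complex and n = d] vec_module[where ?'a = complex and n = d]
    by (auto simp: lsubspace_def VectorSpace.subspace_def submodule_def)
qed

text \<open>Linear combinations are written coordinatewise with ordinary complex sums, the form in
  which \<open>frame_op_mult_vec\<close> produces them.\<close>

lemma lsubspace_sum:
  fixes f :: "'j \<Rightarrow> complex vec"
  assumes "lsubspace d S" "finite J" "\<forall>j\<in>J. f j \<in> S"
  shows "vec d (\<lambda>r. \<Sum>j\<in>J. a j * f j $ r) \<in> S"
  using assms(2,3)
proof (induction J)
  case empty
  have "vec d (\<lambda>r. 0) = (0\<^sub>v d :: complex vec)" by auto
  then show ?case using assms(1) by (simp add: lsubspace_iff)
next
  case (insert i J)
  have "f i \<in> carrier_vec d" using insert.prems assms(1) by (auto simp: lsubspace_iff)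
  then have "vec d (\<lambda>r. \<Sum>j\<in>insert i J. a j * f j $ r)
      = a i \<cdot>\<^sub>v f i + vec d (\<lambda>r. \<Sum>j\<in>J. a j * f j $ r)"
    using insert.hyps by (intro eq_vecI) auto
  then show ?case using insert assms(1) by (simp add: lsubspace_iff)
qed

text \<open>Uniqueness for the definite description: if P and Q both qualify, then Qv - Pv is
  orthogonal to all of S, in particular to Qv and to Pv, hence to itself.\<close>

lemma orth_proj_eqI:
  assumes P: "P \<in> carrier_mat d d"
    and proj: "\<And>v. v \<in> carrier_vec d \<Longrightarrow> P *\<^sub>v v \<in> S"
    and orth: "\<And>v s. v \<in> carrier_vec d \<Longrightarrow> s \<in> S \<Longrightarrow> (v - P *\<^sub>v v) \<bullet>c s = 0"
    and S: "S \<subseteq> carrier_vec d"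
  shows "orth_proj d S = P"
  unfolding orth_proj_def
proof (rule the_equality)
  show "P \<in> carrier_mat d d \<and>
      (\<forall>v\<in>carrier_vec d. P *\<^sub>v v \<in> S \<and> (\<forall>s\<in>S. (v - P *\<^sub>v v) \<bullet>c s = 0))"
    using assms by blast
next
  fix Q assume Q: "Q \<in> carrier_mat d d \<and>
      (\<forall>v\<in>carrier_vec d. Q *\<^sub>v v \<in> S \<and> (\<forall>s\<in>S. (v - Q *\<^sub>v v) \<bullet>c s = 0))"
  have eq: "Q *\<^sub>v v = P *\<^sub>v v" if v: "v \<in> carrier_vec d" for v
  proof -
    let ?p = "P *\<^sub>v v" and ?q = "Q *\<^sub>v v"
    have c: "?p \<in> carrier_vec d" "?q \<in> carrier_vec d" using P Q v by auto
    have diff: "(?q - ?p) \<bullet>c s = 0" if s: "s \<in> S" for s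
    proof -
      have sc: "s \<in> carrier_vec d" using s S by auto
      have "(?q - ?p) \<bullet>c s = (v - ?p) \<bullet>c s - (v - ?q) \<bullet>c s"
        using c v sc by (simp add: cscalar_prod_diff_left[where d = d])
      then show ?thesis using orth[OF v s] Q v s by simp
    qed
    have "(?q - ?p) \<bullet>c (?q - ?p) = (?q - ?p) \<bullet>c ?q - (?q - ?p) \<bullet>c ?p"
      using c by (simp add: cscalar_prod_diff_right[where d = d])
    then have "(?q - ?p) \<bullet>c (?q - ?p) = 0"
      using diff[of ?q] diff[of ?p] proj[OF v] Q v by simp
    then have "?q - ?p = 0\<^sub>v d"
      using conjugate_square_eq_0_vec[of "?q - ?p" d] c by simp
    moreover have "x = y" if xy: "x \<in> carrier_vec d" "y \<in> carrier_vec d" "x - y = 0\<^sub>v d" for x y :: "complex vec"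
    proof (rule eq_vecI)
      fix i assume "i < dim_vec y"
      then have "x $ i - y $ i = (x - y) $ i" by simp
      also have "\<dots> = 0" unfolding xy(3) using \<open>i < dim_vec y\<close> xy(2) by simp
      finally show "x $ i = y $ i" by simp
    qed (use xy in auto)
    ultimately show ?thesis using c by blast
  qed
  show "Q = P"
  proof (rule eq_matI)
    fix i j assume ij: "i < dim_row P" "j < dim_col P"
    then have "Q $$ (i, j) = (Q *\<^sub>v unit_vec d j) $ i"
      using P Q by auto
    also have "\<dots> = (P *\<^sub>v unit_vec d j) $ i"
      using eq[of "unit_vec d j"] by simp
    also have "\<dots> = P $$ (i, j)"
      using P ij by auto
    finally show "Q $$ (i, j) = P $$ (i, j)" .
  qed (use P Q in auto)
qed

subsection \<open>Frame operators\<close>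

text \<open>The frame operator, that is, the sum of the rank-one matrices f_j f_j*.\<close>

definition frame_op :: "nat \<Rightarrow> 'j set \<Rightarrow> ('j \<Rightarrow> complex vec) \<Rightarrow> complex mat"
  where "frame_op d J f = mat d d (\<lambda>(r, c). \<Sum>j\<in>J. f j $ r * cnj (f j $ c))"

lemma frame_op_carrier [simp]: "frame_op d J f \<in> carrier_mat d d"
  by (simp add: frame_op_def)

lemma frame_op_mult_vec:
  assumes "v \<in> carrier_vec d" "\<forall>j\<in>J. f j \<in> carrier_vec d"
  shows "frame_op d J f *\<^sub>v v = vec d (\<lambda>r. \<Sum>j\<in>J. (v \<bullet>c f j) * f j $ r)"
proof (rule eq_vecI)
  fix r assume "r < dim_vec (vec d (\<lambda>r. \<Sum>j\<in>J. (v \<bullet>c f j) * f j $ r))"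
  then have r: "r < d" by simp
  have "(frame_op d J f *\<^sub>v v) $ r = (\<Sum>c<d. (\<Sum>j\<in>J. f j $ r * cnj (f j $ c)) * v $ c)"
    using r assms(1) by (auto simp: frame_op_def scalar_prod_def lessThan_atLeast0 intro!: sum.cong)
  also have "\<dots> = (\<Sum>j\<in>J. \<Sum>c<d. f j $ r * cnj (f j $ c) * v $ c)"
    unfolding sum_distrib_right by (rule sum.swap)
  also have "\<dots> = (\<Sum>j\<in>J. (v \<bullet>c f j) * f j $ r)"
    using assms by (intro sum.cong)
      (auto simp: cscalar_prod_sum[where d = d] sum_distrib_left mult_ac intro!: sum.cong)
  finally show "(frame_op d J f *\<^sub>v v) $ r = vec d (\<lambda>r. \<Sum>j\<in>J. (v \<bullet>c f j) * f j $ r) $ r"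
    using r by simp
qed (simp add: frame_op_def)

text \<open>The sum is Hermitian in v and x and nonnegative for x = v. The orthogonality in
  \<open>orth_proj_S\<close>, the tightness and the positivity of the scaled operator are all read
  off from it.\<close>

lemma cscalar_prod_frame_op:
  assumes "v \<in> carrier_vec d" "x \<in> carrier_vec d" "\<forall>j\<in>J. f j \<in> carrier_vec d"
  shows "(frame_op d J f *\<^sub>v v) \<bullet>c x = (\<Sum>j\<in>J. (v \<bullet>c f j) * cnj (x \<bullet>c f j))"
proof -
  have "(frame_op d J f *\<^sub>v v) \<bullet>c x = (\<Sum>r<d. (\<Sum>j\<in>J. (v \<bullet>c f j) * f j $ r) * cnj (x $ r))"
    using assms by (simp add: frame_op_mult_vec cscalar_prod_sum[OF assms(2)])
  also have "\<dots> = (\<Sum>j\<in>J. \<Sum>r<d. (v \<bullet>c f j) * f j $ r * cnj (x $ r))"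
    unfolding sum_distrib_right by (rule sum.swap)
  also have "\<dots> = (\<Sum>j\<in>J. (v \<bullet>c f j) * cnj (x \<bullet>c f j))"
  proof (rule sum.cong)
    fix j assume "j \<in> J"
    then have fj: "f j \<in> carrier_vec d" using assms by auto
    show "(\<Sum>r<d. (v \<bullet>c f j) * f j $ r * cnj (x $ r)) = (v \<bullet>c f j) * cnj (x \<bullet>c f j)"
      by (simp add: cscalar_prod_sum[OF fj] sum_distrib_left mult_ac)
  qed simp
  finally show ?thesis .
qed

lemma trace_smult: "A \<in> carrier_mat d d \<Longrightarrow> trace (c \<cdot>\<^sub>m A) = c * trace A"
  by (simp add: trace_def sum_distrib_left)

lemma trace_smult_mult:
  assumes "A \<in> carrier_mat d d" "B \<in> carrier_mat d d"
  shows "trace ((c \<cdot>\<^sub>m A) * (k \<cdot>\<^sub>m B)) = c * k * trace (A * B)"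
proof -
  have "(c \<cdot>\<^sub>m A) * (k \<cdot>\<^sub>m B) = c \<cdot>\<^sub>m (k \<cdot>\<^sub>m (A * B))"
    using mult_smult_assoc_mat[OF assms(1), of "k \<cdot>\<^sub>m B" d c] mult_smult_distrib[OF assms, of k] assms
    by simp
  then show ?thesis
    using assms by (simp add: trace_smult[where d = d])
qed

lemma trace_frame_op:
  assumes "\<forall>j\<in>J. f j \<in> carrier_vec d"
  shows "trace (frame_op d J f) = (\<Sum>j\<in>J. f j \<bullet>c f j)"
proof -
  have "trace (frame_op d J f) = (\<Sum>r<d. \<Sum>j\<in>J. f j $ r * cnj (f j $ r))"
    by (simp add: trace_def frame_op_def)
  also have "\<dots> = (\<Sum>j\<in>J. \<Sum>r<d. f j $ r * cnj (f j $ r))"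
    by (rule sum.swap)
  also have "\<dots> = (\<Sum>j\<in>J. f j \<bullet>c f j)"
    using assms by (intro sum.cong) (auto simp: cscalar_prod_sum[where d = d])
  finally show ?thesis .
qed

text \<open>By bilinearity this reduces to rank-one matrices: the trace of f f* g g* is the squared
  modulus of the inner product of f and g.\<close>

lemma trace_frame_op_mult:
  assumes "\<forall>j\<in>J. f j \<in> carrier_vec d" "\<forall>k\<in>K. g k \<in> carrier_vec d"
  shows "trace (frame_op d J f * frame_op d K g)
    = of_real (\<Sum>j\<in>J. \<Sum>k\<in>K. (cmod (f j \<bullet>c g k))\<^sup>2)"
proof -
  have "trace (frame_op d J f * frame_op d K g)
      = (\<Sum>r<d. \<Sum>c<d. (\<Sum>j\<in>J. f j $ r * cnj (f j $ c)) * (\<Sum>k\<in>K. g k $ c * cnj (g k $ r)))"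
    by (simp add: trace_def frame_op_def scalar_prod_def lessThan_atLeast0)
  also have "\<dots> = (\<Sum>r<d. \<Sum>c<d. \<Sum>j\<in>J. \<Sum>k\<in>K.
      (f j $ r * cnj (g k $ r)) * (g k $ c * cnj (f j $ c)))"
    by (simp add: sum_product mult_ac)
  also have "\<dots> = (\<Sum>j\<in>J. \<Sum>k\<in>K. \<Sum>r<d. \<Sum>c<d.
      (f j $ r * cnj (g k $ r)) * (g k $ c * cnj (f j $ c)))"
    by (subst sum.swap[of _ J "{..<d}"], subst sum.swap[of _ K "{..<d}"],
        subst sum.swap[of _ J "{..<d}"], subst sum.swap[of _ K "{..<d}"]) simp
  also have "\<dots> = (\<Sum>j\<in>J. \<Sum>k\<in>K. (f j \<bullet>c g k) * (g k \<bullet>c f j))"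
    using assms by (simp add: cscalar_prod_sum[where d = d] sum_product)
  also have "\<dots> = (\<Sum>j\<in>J. \<Sum>k\<in>K. of_real ((cmod (f j \<bullet>c g k))\<^sup>2))"
  proof (intro sum.cong refl)
    fix j k assume "j \<in> J" "k \<in> K"
    then show "(f j \<bullet>c g k) * (g k \<bullet>c f j) = of_real ((cmod (f j \<bullet>c g k))\<^sup>2)"
      using cscalar_prod_commute[of "g k" d "f j"] assms
      by (simp add: complex_norm_square flip: of_real_power)
  qed
  finally show ?thesis by simp
qed

subsection \<open>Families with Gram matrix N I - w w*\<close>

text \<open>The only possible eigenvalues of n I - w w* are n and n - \<open>card J\<close>, so this
  Gram matrix is invertible when \<open>card J\<close> differs from n. Applied to a whole simplex
  this forces its size; applied to n - 1 of its n vectors it gives their independence.\<close>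

lemma gram_lincomb_eq_0:
  fixes f :: "'j \<Rightarrow> complex vec"
  assumes fin: "finite J" and f: "\<forall>j\<in>J. f j \<in> carrier_vec d"
    and w: "\<forall>j\<in>J. cmod (w j) = 1"
    and gram: "\<forall>i\<in>J. \<forall>j\<in>J. f i \<bullet>c f j = (if i = j then of_nat n else 0) - w i * cnj (w j)"
    and zero: "\<forall>r<d. (\<Sum>j\<in>J. a j * f j $ r) = 0"
    and n: "0 < n" "card J \<noteq> n"
  shows "\<forall>j\<in>J. a j = 0"
proof -
  \<comment> \<open>Pairing the relation with \<open>f i\<close> expresses every coefficient through
    this single number; multiplying by \<open>w i\<close> and summing then gives n c =
    \<open>card J\<close> c.\<close>
  define c where "c = (\<Sum>j\<in>J. a j * w j)"
  have a: "of_nat n * a i = c * cnj (w i)" if i: "i \<in> J" for i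
  proof -
    have fi: "f i \<in> carrier_vec d" using i f by auto
    have "0 = (\<Sum>r<d. (\<Sum>j\<in>J. a j * f j $ r) * cnj (f i $ r))" using zero by simp
    also have "\<dots> = (\<Sum>j\<in>J. \<Sum>r<d. a j * f j $ r * cnj (f i $ r))"
      unfolding sum_distrib_right by (rule sum.swap)
    also have "\<dots> = (\<Sum>j\<in>J. a j * (f j \<bullet>c f i))"
      by (simp add: cscalar_prod_sum[OF fi] sum_distrib_left mult_ac)
    also have "\<dots> = (\<Sum>j\<in>J. (if j = i then of_nat n * a j else 0) - a j * w j * cnj (w i))"
      by (intro sum.cong) (auto simp: gram[rule_format, OF _ i] algebra_simps)
    also have "\<dots> = of_nat n * a i - c * cnj (w i)"
      using i fin by (simp add: sum_subtractf c_def sum_distrib_right)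
    finally show ?thesis by simp
  qed
  have "of_nat n * c = (\<Sum>j\<in>J. (of_nat n * a j) * w j)"
    by (simp add: c_def sum_distrib_left mult_ac)
  also have "\<dots> = (\<Sum>j\<in>J. c)"
  proof (intro sum.cong refl)
    fix j assume j: "j \<in> J"
    then have "w j * cnj (w j) = 1" using w by (simp add: complex_norm_square[symmetric])
    then show "(of_nat n * a j) * w j = c" using a[OF j] by (simp add: mult_ac)
  qed
  finally have "(of_nat n - of_nat (card J)) * c = 0" by (simp add: algebra_simps)
  then have "c = 0" using n by simp
  then show ?thesis using a n by auto
qed

text \<open>Equal vectors at different indices would equate the diagonal entry n - 1 with an
  off-diagonal entry of modulus 1, which n >= 3 excludes.\<close>

lemma gram_inj_on:
  fixes f :: "'j \<Rightarrow> complex vec"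
  assumes w: "\<forall>j\<in>J. cmod (w j) = 1" and n: "3 \<le> n"
    and gram: "\<forall>i\<in>J. \<forall>j\<in>J. f i \<bullet>c f j = (if i = j then of_nat n else 0) - w i * cnj (w j)"
  shows "inj_on f J"
proof (rule inj_onI, rule ccontr)
  fix i j assume ij: "i \<in> J" "j \<in> J" "f i = f j" "i \<noteq> j"
  have "w i * cnj (w i) = 1" using w ij by (simp add: complex_norm_square[symmetric])
  then have "of_nat n - 1 = - (w i * cnj (w j))"
    using gram[rule_format, of i i] gram[rule_format, of i j] ij by simp
  then have "cmod (of_real (real n - 1)) = 1"
    using w ij by (simp add: norm_mult)
  then show False using n by (simp only: norm_of_real)
qed

text \<open>The phases \<open>w\<close> record the switching: multiplying each \<open>f j\<close> by
  \<open>cnj (w j)\<close> turns the Gram matrix into n I - J with J the all-ones matrix, the Gram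
  matrix of a regular simplex.\<close>

locale simplex_family =
  fixes d n :: nat and J :: "'j set" and f :: "'j \<Rightarrow> complex vec" and w :: "'j \<Rightarrow> complex"
  assumes fin: "finite J" and card_J: "card J = n" and n: "3 \<le> n"
    and f: "\<forall>j\<in>J. f j \<in> carrier_vec d"
    and w: "\<forall>j\<in>J. cmod (w j) = 1"
    and gram: "\<forall>i\<in>J. \<forall>j\<in>J. f i \<bullet>c f j = (if i = j then of_nat n else 0) - w i * cnj (w j)"
begin

lemma w_cnj: "j \<in> J \<Longrightarrow> w j * cnj (w j) = 1"
  using w by (simp add: complex_norm_square[symmetric])

lemma gram_diag: "j \<in> J \<Longrightarrow> f j \<bullet>c f j = of_nat n - 1"
  using gram w_cnj by simp

text \<open>The linear relation of the simplex. Since \<open>card J = n\<close>, the Gram matrix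
  annihilates w, so the combination s is orthogonal to every \<open>f i\<close>, hence to
  itself.\<close>

lemma sum_cnj_w_f_eq_0:
  assumes "r < d"
  shows "(\<Sum>j\<in>J. cnj (w j) * f j $ r) = 0"
proof -
  define s where "s = vec d (\<lambda>r. \<Sum>j\<in>J. cnj (w j) * f j $ r)"
  have s: "s \<in> carrier_vec d" by (simp add: s_def)
  have sf: "s \<bullet>c f i = 0" if i: "i \<in> J" for i
  proof -
    have fi: "f i \<in> carrier_vec d" using i f by auto
    have "s \<bullet>c f i = (\<Sum>r<d. (\<Sum>j\<in>J. cnj (w j) * f j $ r) * cnj (f i $ r))"
      by (simp add: cscalar_prod_sum[OF fi] s_def)
    also have "\<dots> = (\<Sum>j\<in>J. \<Sum>r<d. cnj (w j) * f j $ r * cnj (f i $ r))"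
      unfolding sum_distrib_right by (rule sum.swap)
    also have "\<dots> = (\<Sum>j\<in>J. cnj (w j) * (f j \<bullet>c f i))"
      by (simp add: cscalar_prod_sum[OF fi] sum_distrib_left mult_ac)
    also have "\<dots> = (\<Sum>j\<in>J. (if j = i then of_nat n * cnj (w j) else 0) - cnj (w i))"
      using w_cnj by (intro sum.cong) (auto simp: gram[rule_format, OF _ i] algebra_simps)
    also have "\<dots> = 0"
      using i fin card_J by (simp add: sum_subtractf)
    finally show ?thesis .
  qed
  have "s \<bullet>c s = (\<Sum>r<d. s $ r * (\<Sum>j\<in>J. w j * cnj (f j $ r)))"
    by (simp add: cscalar_prod_sum[OF s]) (simp add: s_def)
  also have "\<dots> = (\<Sum>j\<in>J. \<Sum>r<d. s $ r * (w j * cnj (f j $ r)))"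
    unfolding sum_distrib_left by (rule sum.swap)
  also have "\<dots> = (\<Sum>j\<in>J. w j * (s \<bullet>c f j))"
    using f by (intro sum.cong) (auto simp: cscalar_prod_sum[where d = d] sum_distrib_left mult_ac)
  finally have "s = 0\<^sub>v d"
    using sf conjugate_square_eq_0_vec[OF s] by simp
  then have "s $ r = 0" using assms by simp
  then show ?thesis using assms by (simp add: s_def)
qed

abbreviation "S \<equiv> lspan d (f ` J)"
abbreviation "P \<equiv> (1 / of_nat n) \<cdot>\<^sub>m frame_op d J f"

lemma f_image: "f ` J \<subseteq> carrier_vec d"
  using f by auto

lemmas lsubspace_S = lsubspace_lspan[OF f_image]
lemmas S_carrier = lspan_carrier[OF f_image]

lemma f_in_S: "j \<in> J \<Longrightarrow> f j \<in> S"
  using subset_lspan[OF f_image] by auto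

lemma inj_f: "inj_on f J"
  using gram_inj_on[OF w n gram] .

lemma P_mult:
  assumes "v \<in> carrier_vec d"
  shows "P *\<^sub>v v = (1 / of_nat n) \<cdot>\<^sub>v (frame_op d J f *\<^sub>v v)"
  using assms by (intro eq_vecI) (auto simp: frame_op_def scalar_prod_def sum_distrib_left sum_distrib_right sum_divide_distrib mult.assoc)

text \<open>The fixed vectors of P form a subspace, so only the generators need checking. The frame
  operator sends \<open>f i\<close> to n \<open>f i\<close> minus \<open>w i\<close> times the
  vanishing combination of \<open>sum_cnj_w_f_eq_0\<close>.\<close>

lemma P_eq_self:
  assumes "x \<in> S"
  shows "P *\<^sub>v x = x"
proof -
  define T where "T = {x \<in> carrier_vec d. P *\<^sub>v x = x}"
  have P: "P \<in> carrier_mat d d" by simp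
  have P0: "P *\<^sub>v 0\<^sub>v d = 0\<^sub>v d"
    by (intro eq_vecI) (auto simp: frame_op_def scalar_prod_def)
  have "lsubspace d T"
    unfolding lsubspace_iff T_def
    using mult_add_distrib_mat_vec[OF P] mult_mat_vec[OF P] P0 by auto
  moreover have "f ` J \<subseteq> T"
  proof clarify
    fix i assume i: "i \<in> J"
    then have fi: "f i \<in> carrier_vec d" using f by auto
    have "P *\<^sub>v f i = f i"
    proof (rule eq_vecI)
      fix r assume "r < dim_vec (f i)"
      then have r: "r < d" using fi by simp
      have "(P *\<^sub>v f i) $ r = (\<Sum>j\<in>J. (f i \<bullet>c f j) * f j $ r) / of_nat n"
        using r by (simp add: P_mult[OF fi] frame_op_mult_vec[OF fi f])
      also have "(\<Sum>j\<in>J. (f i \<bullet>c f j) * f j $ r)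
          = (\<Sum>j\<in>J. (if j = i then of_nat n * f j $ r else 0) - w i * (cnj (w j) * f j $ r))"
        by (intro sum.cong) (auto simp: gram[rule_format, OF i] algebra_simps)
      also have "\<dots> = of_nat n * f i $ r - w i * (\<Sum>j\<in>J. cnj (w j) * f j $ r)"
        using i fin by (simp add: sum_subtractf sum_distrib_left)
      finally show "(P *\<^sub>v f i) $ r = f i $ r"
        using sum_cnj_w_f_eq_0[OF r] n by simp
    qed (use fi in \<open>simp add: frame_op_def\<close>)
    then show "f i \<in> T" using fi by (simp add: T_def)
  qed
  ultimately show ?thesis using lspan_minimal[of d T "f ` J"] assms by (auto simp: T_def)
qed

lemma cscalar_prod_P:
  assumes "v \<in> carrier_vec d" "x \<in> carrier_vec d"
  shows "(P *\<^sub>v v) \<bullet>c x = (\<Sum>j\<in>J. (v \<bullet>c f j) * cnj (x \<bullet>c f j)) / of_nat n"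
  using cscalar_prod_frame_op[OF assms f] mult_mat_vec_carrier[OF frame_op_carrier assms(1), of J f] assms
  by (simp add: P_mult smult_scalar_prod_distrib[where n = d])

text \<open>P maps into S, fixes S pointwise and is self-adjoint; so for x in S the inner products
  of v and of Pv with x agree.\<close>

lemma orth_proj_S: "orth_proj d S = P"
proof (rule orth_proj_eqI)
  fix v :: "complex vec" assume v: "v \<in> carrier_vec d"
  have "frame_op d J f *\<^sub>v v \<in> S"
    unfolding frame_op_mult_vec[OF v f]
    by (rule lsubspace_sum[OF lsubspace_S fin]) (use f_in_S in auto)
  then show "P *\<^sub>v v \<in> S"
    using lsubspace_S v by (simp add: P_mult lsubspace_iff)
  fix x assume x: "x \<in> S"
  then have xc: "x \<in> carrier_vec d" using S_carrier by auto
  have "v \<bullet>c x = cnj ((P *\<^sub>v x) \<bullet>c v)"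
    using P_eq_self[OF x] cscalar_prod_commute[OF v xc] by simp
  also have "\<dots> = (P *\<^sub>v v) \<bullet>c x"
    using v xc by (simp only: cscalar_prod_P) (simp add: mult.commute)
  finally show "(v - P *\<^sub>v v) \<bullet>c x = 0"
    using v xc mult_mat_vec_carrier[of P d d v]
    by (simp add: cscalar_prod_diff_left[where d = d])
qed (simp_all add: S_carrier)

text \<open>Since P fixes x, the inner product of Px with x is that of x with itself; the frame
  bound is therefore n.\<close>

lemma tight:
  assumes "x \<in> S"
  shows "(\<Sum>j\<in>J. (cmod (x \<bullet>c f j))\<^sup>2) = real n * Re (x \<bullet>c x)"
proof -
  have xc: "x \<in> carrier_vec d" using S_carrier assms by auto
  have "x \<bullet>c x = of_real ((\<Sum>j\<in>J. (cmod (x \<bullet>c f j))\<^sup>2) / real n)"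
    using cscalar_prod_P[OF xc xc] P_eq_self[OF assms]
    by (simp add: complex_norm_square del: of_real_power)
  then have "Re (x \<bullet>c x) = (\<Sum>j\<in>J. (cmod (x \<bullet>c f j))\<^sup>2) / real n"
    by (simp only: Re_complex_of_real)
  then show ?thesis using n by simp
qed

text \<open>After one vector is dropped, the other n - 1 are independent by
  \<open>gram_lincomb_eq_0\<close>, and the linear relation, solved for the dropped vector, puts it
  back into their span.\<close>

lemma ldim_S: "ldim d S = n - 1"
proof -
  obtain k where k: "k \<in> J" using card_J n by fastforce
  define K where "K = J - {k}"
  have K: "finite K" "K \<subseteq> J" "card K = n - 1" "f ` K \<subseteq> carrier_vec d"
    using fin k card_J f by (auto simp: K_def)
  have indpt: "\<not> LinearCombinations.module.lin_dep class_ring (Cspace d) (f ` K)"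
  proof (rule lin_indpt_image)
    fix a assume "\<forall>r<d. (\<Sum>j\<in>K. a j * f j $ r) = 0"
    moreover have "\<forall>i\<in>K. \<forall>j\<in>K. f i \<bullet>c f j = (if i = j then of_nat n else 0) - w i * cnj (w j)"
      using gram K(2) by blast
    ultimately show "\<forall>j\<in>K. a j = 0"
      by (rule_tac gram_lincomb_eq_0[where w = w and n = n and d = d and f = f]) (use K f w n in auto)
  qed (use K inj_f inj_on_subset in auto)
  have "f k \<in> lspan d (f ` K)"
  proof -
    have "f k = vec d (\<lambda>r. \<Sum>j\<in>K. (- w k * cnj (w j)) * f j $ r)"
    proof (rule eq_vecI)
      fix r assume "r < dim_vec (vec d (\<lambda>r. \<Sum>j\<in>K. (- w k * cnj (w j)) * f j $ r))"
      then have r: "r < d" by simp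
      have "0 = w k * (cnj (w k) * f k $ r + (\<Sum>j\<in>K. cnj (w j) * f j $ r))"
        using sum_cnj_w_f_eq_0[OF r] fin k by (simp add: sum.remove K_def)
      also have "\<dots> = f k $ r + (\<Sum>j\<in>K. w k * cnj (w j) * f j $ r)"
        using w_cnj[OF k] by (simp add: distrib_left sum_distrib_left mult.assoc[symmetric])
      finally show "f k $ r = vec d (\<lambda>r. \<Sum>j\<in>K. (- w k * cnj (w j)) * f j $ r) $ r"
        using r by (simp add: sum_negf eq_neg_iff_add_eq_0)
    qed (use f k in auto)
    also have "\<dots> \<in> lspan d (f ` K)"
      by (rule lsubspace_sum) (use lsubspace_lspan subset_lspan K in blast)+
    finally show ?thesis .
  qed
  then have "S \<subseteq> lspan d (f ` K)"
    using subset_lspan[OF K(4)] k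
    by (intro lspan_minimal lsubspace_lspan K) (auto simp: K_def)
  moreover have "lspan d (f ` K) \<subseteq> S"
    using f_in_S K by (intro lspan_minimal lsubspace_S) auto
  ultimately have "ldim d S = card (f ` K)"
    using ldim_lspan_lin_indpt[OF _ K(4) indpt] K(1) by simp
  also have "\<dots> = n - 1"
    using card_image inj_on_subset[OF inj_f K(2)] K(3) by metis
  finally show ?thesis .
qed

lemma trace_P: "trace P = of_nat n - 1"
  using trace_frame_op[OF f] gram_diag card_J n by (simp add: trace_smult[where d = d])

lemma trace_P_P: "trace (P * P) = of_nat n - 1"
proof -
  \<comment> \<open>Tightness at x = \<open>f i\<close> evaluates each row of the double
    sum.\<close>
  have inner: "(\<Sum>j\<in>J. (cmod (f i \<bullet>c f j))\<^sup>2) = real n * (real n - 1)" if i: "i \<in> J" for i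
  proof -
    have "(\<Sum>j\<in>J. (cmod (f i \<bullet>c f j))\<^sup>2) = real n * Re (f i \<bullet>c f i)"
      using tight f_in_S i by blast
    then show ?thesis using gram_diag[OF i] by simp
  qed
  have "trace (P * P) = 1 / of_nat n * (1 / of_nat n) * trace (frame_op d J f * frame_op d J f)"
    by (rule trace_smult_mult[OF frame_op_carrier frame_op_carrier])
  also have "\<dots> = of_nat n - 1"
    using n inner card_J by (simp add: trace_frame_op_mult[OF f f])
  finally show ?thesis .
qed

text \<open>The real factor covers both the state, with c = 1 / (n - 1), and the projection itself,
  with c = 1, from which its self-adjointness is taken.\<close>

lemma pos_semidef_P:
  assumes "0 \<le> c"
  shows "pos_semidef d (of_real c \<cdot>\<^sub>m P)"
proof -
  have adj: "mat_adjoint (of_real c \<cdot>\<^sub>m P) = of_real c \<cdot>\<^sub>m P"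
    by (rule eq_matI) (auto simp: mat_adjoint_def mat_of_rows_def frame_op_def mult.commute)
  have "0 \<le> Re (((of_real c \<cdot>\<^sub>m P) *\<^sub>v v) \<bullet>c v)" if v: "v \<in> carrier_vec d" for v
  proof -
    have Pv: "P *\<^sub>v v \<in> carrier_vec d"
      using v by (intro mult_mat_vec_carrier[of _ d d]) simp_all
    have "(of_real c \<cdot>\<^sub>m P) *\<^sub>v v = of_real c \<cdot>\<^sub>v (P *\<^sub>v v)"
      using v by (intro eq_vecI)
        (auto simp: frame_op_def scalar_prod_def sum_distrib_left sum_distrib_right sum_divide_distrib mult.assoc)
    then have "((of_real c \<cdot>\<^sub>m P) *\<^sub>v v) \<bullet>c v = of_real c * ((P *\<^sub>v v) \<bullet>c v)"
      using Pv v by (simp add: smult_scalar_prod_distrib[where n = d])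
    also have "\<dots> = of_real (c * ((\<Sum>j\<in>J. (cmod (v \<bullet>c f j))\<^sup>2) / real n))"
      unfolding cscalar_prod_P[OF v v] by (simp add: complex_norm_square del: of_real_power)
    finally show ?thesis
      using assms by (simp only: Re_complex_of_real) (simp add: sum_nonneg)
  qed
  then show ?thesis using adj by (simp add: pos_semidef_def)
qed

end

lemma trace_proj_mult:
  assumes "simplex_family d n J f w" "simplex_family d n K g v"
    and "\<forall>j\<in>J. \<forall>k\<in>K. cmod (f j \<bullet>c g k) = 1"
  shows "trace (orth_proj d (lspan d (f ` J)) * orth_proj d (lspan d (g ` K))) = 1"
proof -
  interpret J: simplex_family d n J f w by fact
  interpret K: simplex_family d n K g v by fact
  have "trace (J.P * K.P) = 1 / of_nat n * (1 / of_nat n) * trace (frame_op d J f * frame_op d K g)"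
    by (rule trace_smult_mult[OF frame_op_carrier frame_op_carrier])
  also have "\<dots> = 1"
    using J.n assms(3) J.card_J K.card_J by (simp add: trace_frame_op_mult[OF J.f K.f])
  finally show ?thesis by (simp only: J.orth_proj_S K.orth_proj_S)
qed

section \<open>Switching equivalence and the Gram matrices of simplices\<close>

lemma cscalar_prod_smult:
  fixes x y :: "complex vec"
  assumes "x \<in> carrier_vec d" "y \<in> carrier_vec d"
  shows "(a \<cdot>\<^sub>v x) \<bullet>c (b \<cdot>\<^sub>v y) = a * cnj b * (x \<bullet>c y)"
proof -
  have "(a \<cdot>\<^sub>v x) \<bullet>c (b \<cdot>\<^sub>v y) = (\<Sum>r<d. (a \<cdot>\<^sub>v x) $ r * cnj ((b \<cdot>\<^sub>v y) $ r))"
    using assms by (intro cscalar_prod_sum) simp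
  also have "\<dots> = a * cnj b * (x \<bullet>c y)"
    unfolding cscalar_prod_sum[OF assms(2)] sum_distrib_left
    using assms by (intro sum.cong) auto
  finally show ?thesis .
qed

lemma cscalar_prod_unitary:
  assumes "unitary d U" "x \<in> carrier_vec d" "y \<in> carrier_vec d"
  shows "(U *\<^sub>v x) \<bullet>c (U *\<^sub>v y) = x \<bullet>c y"
proof -
  have U: "U \<in> carrier_mat d d" and UU: "mat_adjoint U * U = 1\<^sub>m d"
    using assms(1) by (auto simp: unitary_def)
  have orth: "(\<Sum>r<d. U $$ (r, a) * cnj (U $$ (r, b))) = (if b = a then 1 else 0)"
    if "a < d" "b < d" for a b
  proof -
    have "(mat_adjoint U * U) $$ (b, a) = (\<Sum>r<d. U $$ (r, a) * cnj (U $$ (r, b)))"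
      using U that by (auto simp: mat_adjoint_def scalar_prod_def lessThan_atLeast0 intro!: sum.cong)
    then show ?thesis using UU that by simp
  qed
  have "(U *\<^sub>v x) \<bullet>c (U *\<^sub>v y)
      = (\<Sum>r<d. (\<Sum>a<d. U $$ (r, a) * x $ a) * (\<Sum>b<d. cnj (U $$ (r, b)) * cnj (y $ b)))"
    using U assms(2,3) by (subst cscalar_prod_sum[where d = d])
      (auto simp: scalar_prod_def lessThan_atLeast0 intro!: sum.cong)
  also have "\<dots> = (\<Sum>r<d. \<Sum>a<d. \<Sum>b<d. x $ a * cnj (y $ b) * (U $$ (r, a) * cnj (U $$ (r, b))))"
    by (simp add: sum_product mult_ac)
  also have "\<dots> = (\<Sum>a<d. \<Sum>b<d. x $ a * cnj (y $ b) * (\<Sum>r<d. U $$ (r, a) * cnj (U $$ (r, b))))"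
    unfolding sum_distrib_left
    by (rule trans[OF sum.swap], rule sum.cong[OF refl], rule sum.swap)
  also have "\<dots> = (\<Sum>a<d. \<Sum>b<d. if b = a then x $ a * cnj (y $ b) else 0)"
    by (intro sum.cong) (auto simp: orth)
  also have "\<dots> = x \<bullet>c y"
    by (simp add: cscalar_prod_sum[OF assms(3)])
  finally show ?thesis .
qed

text \<open>Switching preserves norms and moduli of inner products. The off-diagonal inner products
  of \<Psi> are thus real, negative and unimodular, hence equal to -1. This fixes the Gram matrix
  and then the size; undoing the switching gives the phases for \<Phi>.\<close>

lemma simplex_imp_simplex_family:
  fixes \<Phi> :: "'j \<Rightarrow> complex vec"
  assumes simplex: "simplex d \<Phi> J" and n: "3 \<le> n"
    and \<Phi>: "\<forall>j\<in>J. \<Phi> j \<in> carrier_vec d"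
    and diag: "\<forall>j\<in>J. \<Phi> j \<bullet>c \<Phi> j = of_nat n - 1"
    and off_diag: "\<forall>i\<in>J. \<forall>j\<in>J. i \<noteq> j \<longrightarrow> cmod (\<Phi> i \<bullet>c \<Phi> j) = 1"
  shows "\<exists>w. simplex_family d n J \<Phi> w"
proof -
  obtain \<Psi> S where fin: "finite J" and equiv: "switching_equiv d J \<Phi> \<Psi>" and etf: "etf d S J \<Psi>"
    and card: "card J = ldim d S + 1"
    and neg: "\<forall>i\<in>J. \<forall>j\<in>J. i \<noteq> j \<longrightarrow> \<Psi> i \<bullet>c \<Psi> j \<in> \<real> \<and> Re (\<Psi> i \<bullet>c \<Psi> j) < 0"
    using simplex unfolding simplex_def by blast
  obtain U \<sigma> z where U: "unitary d U" and \<sigma>: "\<sigma> permutes J" and z: "\<forall>j\<in>J. cmod (z j) = 1"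
    and \<Psi>: "\<forall>j\<in>J. \<Psi> j = z j \<cdot>\<^sub>v (U *\<^sub>v \<Phi> (\<sigma> j))"
    using equiv unfolding switching_equiv_def by blast
  have Uc: "U \<in> carrier_mat d d" using U by (simp add: unitary_def)
  have \<sigma>J: "\<sigma> j \<in> J" if "j \<in> J" for j using \<sigma> that by (simp add: permutes_in_image)
  have zz: "z j * cnj (z j) = 1" if "j \<in> J" for j
    using z that by (simp add: complex_norm_square[symmetric])
  have gram_\<Psi>: "\<Psi> i \<bullet>c \<Psi> j = z i * cnj (z j) * (\<Phi> (\<sigma> i) \<bullet>c \<Phi> (\<sigma> j))"
    if "i \<in> J" "j \<in> J" for i j
  proof -
    have c: "\<Phi> (\<sigma> i) \<in> carrier_vec d" "\<Phi> (\<sigma> j) \<in> carrier_vec d" using that \<Phi> \<sigma>J by auto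
    have "\<Psi> i \<bullet>c \<Psi> j = (z i \<cdot>\<^sub>v (U *\<^sub>v \<Phi> (\<sigma> i))) \<bullet>c (z j \<cdot>\<^sub>v (U *\<^sub>v \<Phi> (\<sigma> j)))"
      using that \<Psi> by metis
    then show ?thesis
      using cscalar_prod_smult[OF mult_mat_vec_carrier[OF Uc c(1)] mult_mat_vec_carrier[OF Uc c(2)]]
        cscalar_prod_unitary[OF U c] by metis
  qed
  have off: "\<Psi> i \<bullet>c \<Psi> j = -1" if ij: "i \<in> J" "j \<in> J" "i \<noteq> j" for i j
  proof -
    have "\<sigma> i \<noteq> \<sigma> j" using \<sigma> ij(3) by (metis permutes_inverses(2))
    then have "cmod (\<Psi> i \<bullet>c \<Psi> j) = 1"
      using ij z off_diag \<sigma>J by (simp add: gram_\<Psi> norm_mult)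
    moreover obtain r where r: "\<Psi> i \<bullet>c \<Psi> j = of_real r"
      using neg ij by (metis Reals_cases)
    moreover have "r < 0" using neg ij r by (metis Re_complex_of_real)
    ultimately show ?thesis by simp
  qed
  \<comment> \<open>The factor \<open>1 * cnj 1\<close> gives the Gram hypothesis of the lemmas
    above its literal form, with constant phases 1.\<close>
  have gram1: "\<forall>i\<in>J. \<forall>j\<in>J. \<Psi> i \<bullet>c \<Psi> j = (if i = j then of_nat n else 0) - 1 * cnj 1"
    using off gram_\<Psi> zz diag \<sigma>J by simp
  have S: "lsubspace d S" and \<Psi>S: "\<Psi> ` J \<subseteq> S" using etf by (auto simp: etf_def)
  have \<Psi>c: "\<forall>j\<in>J. \<Psi> j \<in> carrier_vec d" using S \<Psi>S by (auto simp: lsubspace_iff)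
  have inj: "inj_on \<Psi> J"
    using gram_inj_on[of J "\<lambda>_. 1" n \<Psi>] gram1 n by simp
  \<comment> \<open>Otherwise \<Psi> would consist of \<open>card J\<close> independent vectors in a
    space of dimension \<open>card J\<close> - 1.\<close>
  have "card J = n"
  proof (rule ccontr)
    assume ne: "card J \<noteq> n"
    have "\<not> LinearCombinations.module.lin_dep class_ring (Cspace d) (\<Psi> ` J)"
    proof (rule lin_indpt_image[OF fin inj])
      fix a assume "\<forall>r<d. (\<Sum>j\<in>J. a j * \<Psi> j $ r) = 0"
      then show "\<forall>j\<in>J. a j = 0"
        using gram_lincomb_eq_0[OF fin \<Psi>c _ gram1, of a] ne n by simp
    qed (use \<Psi>c in auto)
    from card_lin_indpt_le_ldim[OF S \<Psi>S this] show False
      using card inj by (simp add: card_image)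
  qed
  \<comment> \<open>\<Psi> at index j carries \<Phi> at \<open>\<sigma> j\<close>, so the phase
    belonging to \<Phi> at k is found at the index \<open>\<tau> k\<close>. The conjugate appears on
    solving the equation for the inner product of \<Phi> at k and l.\<close>
  define \<tau> where "\<tau> = inv_into UNIV \<sigma>"
  define w where "w k = cnj (z (\<tau> k))" for k
  have inv: "\<tau> k \<in> J" "\<sigma> (\<tau> k) = k" if "k \<in> J" for k
    using permutes_inv[OF \<sigma>] \<sigma> that by (auto simp: \<tau>_def permutes_in_image permutes_inverses)
  have "\<Phi> k \<bullet>c \<Phi> l = (if k = l then of_nat n else 0) - w k * cnj (w l)" if kl: "k \<in> J" "l \<in> J" for k l
  proof (cases "k = l")
    case True
    then show ?thesis using kl diag zz[OF inv(1)] by (simp add: w_def mult.commute)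
  next
    case False
    let ?i = "\<tau> k" and ?j = "\<tau> l"
    have "?i \<noteq> ?j" using False inv(2) kl by metis
    then have "z ?i * cnj (z ?j) * (\<Phi> k \<bullet>c \<Phi> l) = -1"
      using off[of ?i ?j] gram_\<Psi>[of ?i ?j] inv kl by simp
    moreover have "(z ?i * cnj (z ?i)) * (z ?j * cnj (z ?j)) * (\<Phi> k \<bullet>c \<Phi> l)
        = (cnj (z ?i) * z ?j) * (z ?i * cnj (z ?j) * (\<Phi> k \<bullet>c \<Phi> l))"
      by (simp add: mult_ac)
    ultimately have "(z ?i * cnj (z ?i)) * (z ?j * cnj (z ?j)) * (\<Phi> k \<bullet>c \<Phi> l) = - (cnj (z ?i) * z ?j)"
      by simp
    then show ?thesis using False zz inv(1) kl by (simp add: w_def)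
  qed
  then have "simplex_family d n J \<Phi> w"
    using fin \<open>card J = n\<close> n \<Phi> z inv by unfold_locales (auto simp: w_def)
  then show ?thesis by blast
qed

text \<open>The converse construction: the switching is diagonal with entries
  \<open>cnj (w j)\<close>, the unitary and the permutation are trivial, and the span stays the
  same, so tightness carries over.\<close>

lemma (in simplex_family) simplex: "simplex d f J"
proof -
  define \<Psi> where "\<Psi> j = cnj (w j) \<cdot>\<^sub>v f j" for j
  have fc: "f j \<in> carrier_vec d" if "j \<in> J" for j using f that by auto
  have "unitary d (1\<^sub>m d)"
  proof -
    have "mat_adjoint (1\<^sub>m d) = (1\<^sub>m d :: complex mat)"
      by (rule eq_matI) (auto simp: mat_adjoint_def mat_of_rows_def)
    then show ?thesis by (simp add: unitary_def)
  qed
  then have "switching_equiv d J f \<Psi>"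
    unfolding switching_equiv_def \<Psi>_def
    by (intro exI[of _ "1\<^sub>m d"] exI[of _ id] exI[of _ "\<lambda>j. cnj (w j)"])
      (use fc w in \<open>auto simp: permutes_id\<close>)
  moreover have gram_\<Psi>: "\<Psi> i \<bullet>c \<Psi> j = (if i = j then of_nat n else 0) - 1" if ij: "i \<in> J" "j \<in> J" for i j
  proof -
    have "\<Psi> i \<bullet>c \<Psi> j = cnj (w i) * w j * (f i \<bullet>c f j)"
      using fc ij by (simp add: \<Psi>_def cscalar_prod_smult[where d = d])
    also have "\<dots> = (if i = j then of_nat n * (w i * cnj (w i)) else 0) - (w i * cnj (w i)) * (w j * cnj (w j))"
      by (simp add: gram[rule_format, OF ij] algebra_simps)
    finally show ?thesis using w_cnj ij by simp
  qed
  moreover have "etf d S J \<Psi>"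
  proof -
    have "\<Psi> ` J \<subseteq> S"
      using f_in_S lsubspace_S by (auto simp: \<Psi>_def lsubspace_iff)
    moreover have "cmod (x \<bullet>c \<Psi> j) = cmod (x \<bullet>c f j)" if "x \<in> S" "j \<in> J" for x j
    proof -
      have "x \<in> carrier_vec d" using S_carrier that by auto
      then have "x \<bullet>c \<Psi> j = w j * (x \<bullet>c f j)"
        using cscalar_prod_smult[of x d "f j" 1 "cnj (w j)"] fc that by (simp add: \<Psi>_def)
      then show ?thesis using w that by (simp add: norm_mult)
    qed
    then have "\<forall>x\<in>S. (\<Sum>j\<in>J. (cmod (x \<bullet>c \<Psi> j))\<^sup>2) = real n * Re (x \<bullet>c x)"
      using tight by simp
    moreover have "\<forall>j\<in>J. \<Psi> j \<bullet>c \<Psi> j = of_real (real n - 1)"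
      using gram_\<Psi> by simp
    moreover have "\<forall>i\<in>J. \<forall>j\<in>J. i \<noteq> j \<longrightarrow> cmod (\<Psi> i \<bullet>c \<Psi> j) = 1"
      using gram_\<Psi> by simp
    moreover have "0 < real n" using n by simp
    ultimately show ?thesis
      unfolding etf_def using lsubspace_S fin by blast
  qed
  ultimately show ?thesis
    unfolding simplex_def using fin ldim_S card_J n
    by (intro conjI exI[of _ \<Psi>] exI[of _ S]) auto
qed

subsection \<open>Block vectors\<close>

lemma sum_lessThan_mult:
  fixes F :: "nat \<Rightarrow> 'a::comm_monoid_add"
  shows "(\<Sum>i<h * N. F i) = (\<Sum>p<h. \<Sum>a<N. F (p * N + a))"
proof -
  have "sum F {p * N..<p * N + N} = (\<Sum>a<N. F (p * N + a))" for p
    using sum.shift_bounds_nat_ivl[of F 0 "p * N" N] by (simp add: lessThan_atLeast0 add.commute)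
  then show ?thesis
    using sum.nat_group[of F N h] by simp
qed

lemma nth_concat_uniform:
  assumes "\<forall>xs\<in>set xss. length xs = N" "p < length xss" "b < N"
  shows "concat xss ! (p * N + b) = xss ! p ! b"
  using assms
proof (induction xss arbitrary: p)
  case (Cons xs xss)
  then show ?case by (cases p) (auto simp: nth_append add.assoc)
qed simp

text \<open>With the identity as first factor the Kronecker product is block diagonal, so only block
  p of v contributes.\<close>

lemma kron_one_mult_vec:
  assumes B: "B \<in> carrier_mat N N" and v: "v \<in> carrier_vec (h * N)" and p: "p < h" and a: "a < N"
  shows "(kron (1\<^sub>m h) B *\<^sub>v v) $ (p * N + a) = (\<Sum>b<N. B $$ (a, b) * v $ (p * N + b))"
proof -
  have lt: "p * N + a < h * N"
  proof -
    have "p * N + a < Suc p * N" using a by simp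
    also have "\<dots> \<le> h * N" using p by (intro mult_le_mono1) simp
    finally show ?thesis .
  qed
  have "(kron (1\<^sub>m h) B *\<^sub>v v) $ (p * N + a)
      = (\<Sum>j<h * N. 1\<^sub>m h $$ (p, j div N) * B $$ (a, j mod N) * v $ j)"
    using B v lt a by (auto simp: kron_def scalar_prod_def lessThan_atLeast0 intro!: sum.cong)
  also have "\<dots> = (\<Sum>q<h. \<Sum>b<N. 1\<^sub>m h $$ (p, q) * B $$ (a, b) * v $ (q * N + b))"
    unfolding sum_lessThan_mult by (intro sum.cong) auto
  also have "\<dots> = (\<Sum>q<h. if q = p then \<Sum>b<N. B $$ (a, b) * v $ (q * N + b) else 0)"
    using p by (intro sum.cong) auto
  also have "\<dots> = (\<Sum>b<N. B $$ (a, b) * v $ (p * N + b))"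
    using p by simp
  finally show ?thesis .
qed

subsection \<open>The group and its reflection\<close>

lemma distinct_grp_list: "distinct (grp_list m)"
  unfolding grp_list_def by (intro distinct_product_lists) auto

lemma grp_list_nth_in: "a < prod_list m \<Longrightarrow> grp_list m ! a \<in> grp m"
  using set_grp_list length_grp_list nth_mem by metis

lemma grp_list_nth_eq_iff:
  "a < prod_list m \<Longrightarrow> b < prod_list m \<Longrightarrow> grp_list m ! a = grp_list m ! b \<longleftrightarrow> a = b"
  by (simp add: nth_eq_iff_index_eq distinct_grp_list length_grp_list)

lemma finite_grp: "finite (grp m)"
  using set_grp_list by (metis List.finite_set)

lemma card_grp: "card (grp m) = prod_list m"
  using distinct_card[OF distinct_grp_list] by (metis set_grp_list length_grp_list)

lemma sum_grp_list: "(\<Sum>a<prod_list m. F (grp_list m ! a)) = (\<Sum>x\<in>grp m. F x)"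
  using bij_betw_nth[OF distinct_grp_list refl refl, of m]
  by (intro sum.reindex_bij_betw) (simp add: set_grp_list length_grp_list)

lemma reflect_nth: "l < length m \<Longrightarrow> reflect m x ! l = m ! l - x ! l - 1"
  by (simp add: reflect_def)

lemma length_reflect: "length (reflect m x) = length m"
  by (simp add: reflect_def)

lemma reflect_in: "x \<in> grp m \<Longrightarrow> reflect m x \<in> grp m"
  by (force simp: grp_def reflect_def)

lemma reflect_reflect: "x \<in> grp m \<Longrightarrow> reflect m (reflect m x) = x"
  by (rule nth_equalityI) (auto simp: grp_def reflect_def)

text \<open>Reflection reverses the lexicographic order about the centre. In the induction, oddness
  gives n = 2t + 1, and the leading coordinates n - a - 1 and a lie on opposite sides of t or are
  both equal to it.\<close>

lemma lex_less_reflect_center: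
  assumes "\<forall>n\<in>set m. odd n" "x \<in> grp m"
  shows "lex_less (reflect m x) (center m) \<longleftrightarrow> x \<noteq> center m \<and> \<not> lex_less x (center m)"
  using assms
proof (induction m arbitrary: x)
  case Nil
  then show ?case by (simp add: grp_def center_def reflect_def lex_less_def)
next
  case (Cons n m)
  obtain a y where x: "x = a # y" using Cons.prems(2) by (cases x) (auto simp: grp_def)
  have a: "a < n" and y: "y \<in> grp m"
    using Cons.prems(2) by (force simp: grp_def x)+
  have IH: "lex_less (reflect m y) (center m) \<longleftrightarrow> y \<noteq> center m \<and> \<not> lex_less y (center m)"
    using Cons y by simp
  have r: "reflect (n # m) (a # y) = (n - a - 1) # reflect m y"
    by (simp add: reflect_def map_upt_Suc del: upt_Suc)
  have len: "length y = length m" "length (reflect m y) = length m" "length (center m) = length m"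
    using y by (auto simp: grp_def reflect_def center_def)
  obtain t where t: "n = 2 * t + 1" using Cons.prems(1) by (auto elim: oddE)
  have c: "center (n # m) = t # center m" by (simp add: center_def t)
  have arith: "n - a - 1 < t \<longleftrightarrow> t < a" "n - a - 1 = t \<longleftrightarrow> a = t" using a t by auto
  show ?case unfolding x r c lex_less_Cons len arith IH using a t by auto
qed

lemma center_in: "\<forall>n\<in>set m. odd n \<Longrightarrow> center m \<in> grp m"
proof -
  assume "\<forall>n\<in>set m. odd n"
  then have "(n - 1) div 2 < n" if "n \<in> set m" for n
    using that by (cases n) auto
  then show ?thesis by (auto simp: grp_def center_def)
qed

lemma lex_less_irrefl: "\<not> lex_less x x"
  by (induction x) (auto simp: lex_less_def)

text \<open>Both directions come from the order criterion alone. At a fixed point other than the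
  centre it would make lying below the centre equivalent to its negation; applied to the centre and
  to its reflection it forces the two to coincide.\<close>

lemma reflect_eq_self_iff:
  assumes "\<forall>n\<in>set m. odd n" "x \<in> grp m"
  shows "reflect m x = x \<longleftrightarrow> x = center m"
proof
  assume "reflect m x = x"
  then show "x = center m" using lex_less_reflect_center[OF assms] by auto
next
  have "reflect m (center m) = center m"
    using lex_less_reflect_center[OF assms(1), of "center m"]
      lex_less_reflect_center[OF assms(1), of "reflect m (center m)"]
      center_in[OF assms(1)] reflect_in[of "center m" m] reflect_reflect[of "center m" m] lex_less_irrefl
    by metis
  then show "x = center m \<Longrightarrow> reflect m x = x" by simp
qed

text \<open>The index set of the blocks of \<open>psi\<close>: one representative of each
  two-element orbit of the reflection.\<close>

definition half :: "nat list \<Rightarrow> nat list set"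
  where "half m = {i \<in> grp m. lex_less i (center m)}"

text \<open>G is the disjoint union of the centre, \<open>half m\<close> and its reflection.
  Consequently the halvings in \<open>gs_pi\<close> and \<open>gs_dim\<close> are exact.\<close>

lemma card_half:
  assumes "\<forall>n\<in>set m. odd n"
  shows "prod_list m = 2 * card (half m) + 1"
proof -
  have inj: "inj_on (reflect m) (half m)"
    by (rule inj_on_inverseI[of _ "reflect m"]) (simp add: half_def reflect_reflect)
  have "grp m = insert (center m) (half m \<union> reflect m ` half m)"
  proof (intro equalityI subsetI)
    fix x assume x: "x \<in> grp m"
    show "x \<in> insert (center m) (half m \<union> reflect m ` half m)"
    proof (cases "x = center m \<or> lex_less x (center m)")
      case False
      then have "reflect m x \<in> half m"
        using lex_less_reflect_center[OF assms x] reflect_in[OF x] by (simp add: half_def)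
      then have "reflect m (reflect m x) \<in> reflect m ` half m" by blast
      then show ?thesis using reflect_reflect[OF x] by simp
    qed (use x in \<open>auto simp: half_def\<close>)
  qed (use center_in[OF assms] reflect_in in \<open>auto simp: half_def\<close>)
  moreover have "half m \<inter> reflect m ` half m = {}"
  proof -
    have "reflect m i \<notin> half m" if "i \<in> half m" for i
      using lex_less_reflect_center[OF assms, of i] that by (simp add: half_def)
    then show ?thesis by blast
  qed
  moreover have "center m \<notin> half m" by (simp add: half_def lex_less_irrefl)
  moreover have "center m \<notin> reflect m ` half m"
  proof
    assume "center m \<in> reflect m ` half m"
    then obtain i where i: "i \<in> half m" "center m = reflect m i" by blast
    then have ig: "i \<in> grp m" by (simp add: half_def)
    have "reflect m (center m) = center m"
      using reflect_eq_self_iff[OF assms center_in[OF assms]] by simp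
    then have "i = center m" using i(2) reflect_reflect[OF ig] by simp
    then show False using i(1) \<open>center m \<notin> half m\<close> by simp
  qed
  moreover have "finite (half m)" using finite_grp by (simp add: half_def)
  ultimately have "card (grp m) = Suc (card (half m) + card (reflect m ` half m))"
    by (simp add: card_Un_disjoint)
  then show ?thesis using card_image[OF inj] card_grp by simp
qed

text \<open>\<open>phi m i\<close> as a function on G, so that later sums run over group elements
  and not over positions in \<open>grp_list\<close>.\<close>

definition phi_fun :: "nat list \<Rightarrow> nat list \<Rightarrow> nat list \<Rightarrow> complex"
  where "phi_fun m i x = of_bool (x = i) - of_bool (x = reflect m i)"

text \<open>The operator \<open>\<Sum> \<phi>\<^sub>i \<phi>\<^sub>i\<^sup>*\<close> is the identity minus the reflection.\<close>

lemma sum_half_phi_fun: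
  assumes odd: "\<forall>n\<in>set m. odd n" and x: "x \<in> grp m" and y: "y \<in> grp m"
  shows "(\<Sum>i\<in>half m. phi_fun m i x * phi_fun m i y) = of_bool (x = y) - of_bool (x = reflect m y)"
proof -
  have fin: "finite (half m)" using finite_grp by (simp add: half_def)
  have rx: "reflect m x \<in> grp m" and ry: "reflect m y \<in> grp m" using x y reflect_in by auto
  \<comment> \<open>The reflection is an involution, so the indicators can be read as conditions on
    i; the sum over i then only picks out points.\<close>
  have phi: "phi_fun m i z = of_bool (i = z) - of_bool (i = reflect m z)"
    if "i \<in> half m" "z \<in> grp m" for i z
    using that reflect_reflect by (auto simp: phi_fun_def half_def)
  have ind: "(\<Sum>i\<in>half m. of_bool (i = u) * of_bool (i = v)) = (of_bool (u = v \<and> u \<in> half m) :: complex)"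
    for u v
  proof -
    have "(\<Sum>i\<in>half m. of_bool (i = u) * of_bool (i = v))
        = (\<Sum>i\<in>half m. if i = u then (of_bool (u = v) :: complex) else 0)"
      by (intro sum.cong) auto
    then show ?thesis using fin by auto
  qed
  have "(\<Sum>i\<in>half m. phi_fun m i x * phi_fun m i y)
      = (\<Sum>i\<in>half m. of_bool (i = x) * of_bool (i = y) - of_bool (i = x) * of_bool (i = reflect m y)
          - of_bool (i = reflect m x) * of_bool (i = y) + of_bool (i = reflect m x) * of_bool (i = reflect m y))"
    by (intro sum.cong refl) (simp only: phi x y, simp add: algebra_simps)
  also have "\<dots> = of_bool (x = y \<and> x \<in> half m) - of_bool (x = reflect m y \<and> x \<in> half m)
      - of_bool (reflect m x = y \<and> reflect m x \<in> half m)
      + of_bool (reflect m x = reflect m y \<and> reflect m x \<in> half m)"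
    by (simp only: sum.distrib sum_subtractf ind)
  also have "\<dots> = of_bool (x = y) - of_bool (x = reflect m y)"
  proof -
    have half_r: "reflect m x \<in> half m \<longleftrightarrow> x \<noteq> center m \<and> x \<notin> half m"
      using lex_less_reflect_center[OF odd x] rx x by (auto simp: half_def)
    have ref: "reflect m x = y \<longleftrightarrow> x = reflect m y" "reflect m x = reflect m y \<longleftrightarrow> x = y"
      using reflect_reflect x y by metis+
    have c: "center m \<notin> half m" by (simp add: half_def lex_less_irrefl)
    \<comment> \<open>A, R, H, C stand for x = y, x = \<open>reflect m y\<close>, x in
      \<open>half m\<close>, x = \<open>center m\<close>. At the centre A and R coincide and H
      fails; elsewhere A and R exclude each other.\<close>
    have bool: "of_bool (A \<and> H) - of_bool (R \<and> H) - of_bool (R \<and> \<not> C \<and> \<not> H)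
        + of_bool (A \<and> \<not> C \<and> \<not> H) = (of_bool A - of_bool R :: complex)"
      if "C \<Longrightarrow> R = A \<and> \<not> H" "\<not> C \<Longrightarrow> \<not> (A \<and> R)" for A R H C
      using that by (cases A; cases R; cases H; cases C) simp_all
    show ?thesis
      unfolding ref half_r
    proof (rule bool)
      assume C: "x = center m"
      then have "reflect m x = x" using reflect_eq_self_iff[OF odd x] by simp
      then show "(x = reflect m y) = (x = y) \<and> x \<notin> half m" using ref(1) C c by metis
    next
      assume "x \<noteq> center m"
      then show "\<not> (x = y \<and> x = reflect m y)"
        using reflect_eq_self_iff[OF odd x] by metis
    qed
  qed
  finally show ?thesis .
qed

section \<open>Subtraction in the group and midpoints\<close>

text \<open>The modulus is added first so that the subtraction of natural numbers does not truncate
  when \<open>k ! l\<close> is at most \<open>m ! l\<close>.\<close>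

definition grp_sub :: "nat list \<Rightarrow> nat list \<Rightarrow> nat list \<Rightarrow> nat list"
  where "grp_sub m a k = map (\<lambda>l. (a ! l + m ! l - k ! l) mod m ! l) [0..<length m]"

lemma length_grp_sub: "length (grp_sub m a k) = length m"
  by (simp add: grp_sub_def)

lemma grp_sub_nth: "l < length m \<Longrightarrow> grp_sub m a k ! l = (a ! l + m ! l - k ! l) mod m ! l"
  by (simp add: grp_sub_def)

lemma mod_less_double: "x < 2 * n \<Longrightarrow> x mod n = (if x < n then x else x - n)" for x n :: nat
  by (simp add: le_mod_geq)

lemma grp_nth_pos: "x \<in> grp m \<Longrightarrow> l < length m \<Longrightarrow> 0 < m ! l"
  by (auto simp: grp_def intro: gr_zeroI)

lemma grp_add_in:
  assumes "x \<in> grp m"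
  shows "grp_add m x k \<in> grp m"
  using grp_nth_pos[OF assms] by (simp add: grp_def grp_add_def)

lemma grp_sub_in:
  assumes "x \<in> grp m"
  shows "grp_sub m x k \<in> grp m"
  using grp_nth_pos[OF assms] by (simp add: grp_def grp_sub_def)

lemma grp_sub_add:
  assumes "x \<in> grp m" "k \<in> grp m"
  shows "grp_sub m (grp_add m x k) k = x"
proof (rule nth_equalityI)
  fix l assume "l < length (grp_sub m (grp_add m x k) k)"
  then have l: "l < length m" by (simp add: grp_sub_def)
  then have "x ! l < m ! l" "k ! l < m ! l" using assms by (auto simp: grp_def)
  then have "((x ! l + k ! l) mod m ! l + m ! l - k ! l) mod m ! l = x ! l"
    by (cases "x ! l + k ! l < m ! l") (auto simp: mod_less_double)
  then show "grp_sub m (grp_add m x k) k ! l = x ! l"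
    using l by (simp add: grp_sub_def grp_add_def)
qed (use assms in \<open>simp add: grp_sub_def grp_def\<close>)

lemma grp_add_sub:
  assumes "x \<in> grp m" "k \<in> grp m"
  shows "grp_add m (grp_sub m x k) k = x"
proof (rule nth_equalityI)
  fix l assume "l < length (grp_add m (grp_sub m x k) k)"
  then have l: "l < length m" by (simp add: grp_add_def)
  then have "x ! l < m ! l" "k ! l < m ! l" using assms by (auto simp: grp_def)
  then have "((x ! l + m ! l - k ! l) mod m ! l + k ! l) mod m ! l = x ! l"
    by (cases "x ! l < k ! l") (auto simp: mod_less_double)
  then show "grp_add m (grp_sub m x k) k ! l = x ! l"
    using l by (simp add: grp_sub_def grp_add_def)
qed (use assms in \<open>simp add: grp_add_def grp_def\<close>)

lemma bij_betw_grp_add: "k \<in> grp m \<Longrightarrow> bij_betw (\<lambda>x. grp_add m x k) (grp m) (grp m)"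
  by (rule bij_betw_byWitness[of _ "\<lambda>x. grp_sub m x k"])
    (auto simp: grp_sub_add grp_add_sub grp_add_in grp_sub_in)

text \<open>The equation says a - k = -(a - k') - 1 modulo n, that is 2a + 1 = k + k', which has one
  solution because 2 is invertible modulo the odd n.\<close>

lemma ex1_midpoint_nat:
  fixes n k k' :: nat
  assumes "odd n" "k < n" "k' < n"
  shows "\<exists>!a. a < n \<and> (a + n - k) mod n = n - (a + n - k') mod n - 1"
proof -
  have md: "(a + n - j) mod n = (if j \<le> a then a - j else a + n - j)" if "a < n" "j < n" for a j
    using that by (simp add: mod_less_double)
  \<comment> \<open>Both 2a + 1 and k + k' lie below 2n, so being congruent modulo n leaves only the
    differences 0, n and -n.\<close>
  have iff: "(a + n - k) mod n = n - (a + n - k') mod n - 1 \<longleftrightarrow>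
      (2 * a + 1 = k + k' \<or> 2 * a + 1 = k + k' + n \<or> 2 * a + 1 + n = k + k')" if "a < n" for a
    using md[OF that assms(2)] md[OF that assms(3)] that assms by (auto split: if_splits)
  obtain t where t: "n = 2 * t + 1" using assms(1) by (auto elim: oddE)
  \<comment> \<open>For an odd sum 2s + 1 take a = s. For an even sum 2s the parity must be repaired
    by n = 2t + 1: a is s + t, or s - t - 1 when that is too large.\<close>
  have "\<exists>a. a < n \<and> (2 * a + 1 = k + k' \<or> 2 * a + 1 = k + k' + n \<or> 2 * a + 1 + n = k + k')"
  proof (cases "odd (k + k')")
    case True
    then obtain s where "k + k' = 2 * s + 1" by (rule oddE)
    then show ?thesis using assms by (intro exI[of _ s]) auto
  next
    case False
    then obtain s where s: "k + k' = 2 * s" by blast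
    show ?thesis
    proof (cases "s + t < n")
      case True
      then show ?thesis using s t by (intro exI[of _ "s + t"]) auto
    next
      case False
      then show ?thesis using s t assms by (intro exI[of _ "s - t - 1"]) auto
    qed
  qed
  then obtain a where a: "a < n" "2 * a + 1 = k + k' \<or> 2 * a + 1 = k + k' + n \<or> 2 * a + 1 + n = k + k'"
    by blast
  \<comment> \<open>Two solutions give odd numbers 2x + 1 and 2y + 1 differing by 0, n or 2n up to
    sign; n is excluded by parity and 2n by size.\<close>
  have uniq: "y = x" if "x < n" "y < n" "2 * x + 1 = S \<or> 2 * x + 1 = S + n \<or> 2 * x + 1 + n = S"
    "2 * y + 1 = S \<or> 2 * y + 1 = S + n \<or> 2 * y + 1 + n = S" for x y S
  proof -
    have "2 * x + 1 \<noteq> 2 * y + 1 + n" "2 * y + 1 \<noteq> 2 * x + 1 + n"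
      unfolding t by presburger+
    moreover have "2 * x + 1 \<noteq> 2 * y + 1 + 2 * n" "2 * y + 1 \<noteq> 2 * x + 1 + 2 * n"
      using that(1,2) by linarith+
    ultimately show ?thesis
      using that(3,4) by (elim disjE) simp_all
  qed
  show ?thesis
  proof (rule ex1I[of _ a])
    show "a < n \<and> (a + n - k) mod n = n - (a + n - k') mod n - 1" using a iff by blast
    fix b assume b: "b < n \<and> (b + n - k) mod n = n - (b + n - k') mod n - 1"
    then have "2 * b + 1 = k + k' \<or> 2 * b + 1 = k + k' + n \<or> 2 * b + 1 + n = k + k'"
      using iff by blast
    then show "b = a" using uniq a b by blast
  qed
qed

text \<open>The condition decouples into one midpoint equation per coordinate, and the list of the
  unique coordinate solutions is the unique solution.\<close>

lemma ex1_midpoint: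
  assumes odd: "\<forall>n\<in>set m. odd n" and k: "k \<in> grp m" "k' \<in> grp m"
  shows "\<exists>!a. a \<in> grp m \<and> grp_sub m a k = reflect m (grp_sub m a k')"
proof -
  define Q where "Q = (\<lambda>l b. b < m ! l \<and> (b + m ! l - k ! l) mod m ! l = m ! l - (b + m ! l - k' ! l) mod m ! l - 1)"
  have ex1: "\<exists>!b. Q l b" if "l < length m" for l
    unfolding Q_def using that k odd by (intro ex1_midpoint_nat) (auto simp: grp_def)
  have iff: "a \<in> grp m \<and> grp_sub m a k = reflect m (grp_sub m a k') \<longleftrightarrow>
      length a = length m \<and> (\<forall>l<length m. Q l (a ! l))" for a
  proof -
    have "grp_sub m a k = reflect m (grp_sub m a k') \<longleftrightarrow>
        (\<forall>l<length m. grp_sub m a k ! l = reflect m (grp_sub m a k') ! l)"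
      by (simp add: list_eq_iff_nth_eq length_grp_sub length_reflect)
    also have "\<dots> \<longleftrightarrow> (\<forall>l<length m.
        (a ! l + m ! l - k ! l) mod m ! l = m ! l - (a ! l + m ! l - k' ! l) mod m ! l - 1)"
      by (simp only: grp_sub_nth reflect_nth cong: imp_cong)
    finally have "grp_sub m a k = reflect m (grp_sub m a k') \<longleftrightarrow> (\<forall>l<length m.
        (a ! l + m ! l - k ! l) mod m ! l = m ! l - (a ! l + m ! l - k' ! l) mod m ! l - 1)" .
    then show ?thesis
      by (simp only: grp_def Q_def mem_Collect_eq imp_conjR all_conj_distrib conj_assoc)
  qed
  define a where "a = map (\<lambda>l. THE b. Q l b) [0..<length m]"
  have a: "Q l (a ! l)" if "l < length m" for l
    using theI'[OF ex1[OF that]] that by (simp add: a_def)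
  have len: "length a = length m" by (simp add: a_def)
  show ?thesis
    unfolding iff
  proof (rule ex1I[of _ a])
    show "length a = length m \<and> (\<forall>l<length m. Q l (a ! l))" using a len by blast
    fix b assume b: "length b = length m \<and> (\<forall>l<length m. Q l (b ! l))"
    then have lb: "length b = length m" by (rule conjunct1)
    show "b = a"
    proof (rule nth_equalityI)
      fix l assume "l < length b"
      then have l: "l < length m" by (simp only: lb)
      have "Q l (b ! l)" using b l by blast
      moreover have "Q l (a ! l)" by (rule a[OF l])
      ultimately show "b ! l = a ! l" using ex1[OF l] by blast
    qed (simp only: lb len)
  qed
qed

text \<open>In the notation of the paper, \<open>(k + k' - 1)/2\<close>.\<close>

definition midpoint :: "nat list \<Rightarrow> nat list \<Rightarrow> nat list \<Rightarrow> nat list"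
  where "midpoint m k k' = (THE a. a \<in> grp m \<and> grp_sub m a k = reflect m (grp_sub m a k'))"

lemma midpoint_iff:
  assumes "\<forall>n\<in>set m. odd n" "k \<in> grp m" "k' \<in> grp m"
  shows "a \<in> grp m \<and> grp_sub m a k = reflect m (grp_sub m a k') \<longleftrightarrow> a = midpoint m k k'"
proof -
  note ex1 = ex1_midpoint[OF assms]
  show ?thesis
  proof
    assume "a \<in> grp m \<and> grp_sub m a k = reflect m (grp_sub m a k')"
    from the1_equality[OF ex1 this] show "a = midpoint m k k'"
      by (simp only: midpoint_def)
  next
    assume "a = midpoint m k k'"
    then show "a \<in> grp m \<and> grp_sub m a k = reflect m (grp_sub m a k')"
      using theI'[OF ex1] by (simp only: midpoint_def)
  qed
qed

subsection \<open>Coordinates of the frame vectors\<close>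

definition half_list :: "nat list \<Rightarrow> nat list list"
  where "half_list m = filter (\<lambda>i. lex_less i (center m)) (grp_list m)"

lemma set_half_list: "set (half_list m) = half m"
  by (auto simp: half_list_def half_def set_grp_list)

lemma distinct_half_list: "distinct (half_list m)"
  by (simp add: half_list_def distinct_grp_list)

lemma length_half_list: "length (half_list m) = card (half m)"
  using distinct_card[OF distinct_half_list] by (simp add: set_half_list)

lemma sum_half_list: "(\<Sum>p<card (half m). F (half_list m ! p)) = (\<Sum>i\<in>half m. F i)"
  using bij_betw_nth[OF distinct_half_list refl refl, of m]
  by (intro sum.reindex_bij_betw) (simp add: set_half_list length_half_list)

lemma phi_carrier: "phi m i \<in> carrier_vec (prod_list m)"
  by (simp add: phi_def basis_vec_def)

lemma phi_index: "a < prod_list m \<Longrightarrow> phi m i $ a = phi_fun m i (grp_list m ! a)"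
  by (simp add: phi_def basis_vec_def phi_fun_def)

lemma psi_eq: "psi m = vec_of_list (concat (map (\<lambda>i. list_of_vec (phi m i)) (half_list m)))"
  by (simp only: psi_def half_list_def)

lemma psi_carrier: "psi m \<in> carrier_vec (card (half m) * prod_list m)"
proof (rule carrier_vecI)
  have dim: "dim_vec (phi m i) = prod_list m" for i using phi_carrier by (rule carrier_vecD)
  show "dim_vec (psi m) = card (half m) * prod_list m"
    by (simp add: psi_eq length_concat o_def sum_list_triv dim length_half_list)
qed

lemma psi_index:
  assumes "p < card (half m)" "b < prod_list m"
  shows "psi m $ (p * prod_list m + b) = phi_fun m (half_list m ! p) (grp_list m ! b)"
proof -
  let ?xss = "map (\<lambda>i. list_of_vec (phi m i)) (half_list m)"
  have dim: "dim_vec (phi m i) = prod_list m" for i using phi_carrier by (rule carrier_vecD)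
  have "psi m $ (p * prod_list m + b) = concat ?xss ! (p * prod_list m + b)"
    by (simp only: psi_eq vec_of_list_index)
  also have "\<dots> = ?xss ! p ! b"
    using assms by (intro nth_concat_uniform) (auto simp: dim length_half_list)
  also have "\<dots> = phi m (half_list m ! p) $ b"
    using assms by (simp add: length_half_list list_of_vec_index)
  finally show ?thesis using assms by (simp add: phi_index)
qed

definition character :: "nat list \<Rightarrow> (nat \<Rightarrow> complex) \<Rightarrow> nat list \<Rightarrow> nat list \<Rightarrow> complex"
  where "character m \<zeta> \<kappa> x = (\<Prod>l<length m. \<zeta> l ^ (\<kappa> ! l * x ! l))"

lemma modul_op_carrier: "modul_op m \<zeta> \<kappa> \<in> carrier_mat (prod_list m) (prod_list m)"
  by (rule carrier_matI) (simp_all add: modul_op_def length_grp_list)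

lemma transl_op_carrier: "transl_op m k \<in> carrier_mat (prod_list m) (prod_list m)"
  by (rule carrier_matI) (simp_all add: transl_op_def length_grp_list)

lemma modul_transl_index:
  assumes "a < prod_list m" "b < prod_list m"
  shows "(modul_op m \<zeta> \<kappa> * transl_op m k) $$ (a, b) =
    (if grp_list m ! a = grp_add m (grp_list m ! b) k then character m \<zeta> \<kappa> (grp_list m ! a) else 0)"
proof -
  have M: "modul_op m \<zeta> \<kappa> $$ (a, c) = (if c = a then character m \<zeta> \<kappa> (grp_list m ! a) else 0)"
    if "c < prod_list m" for c
    using that assms grp_list_nth_eq_iff[of a m c]
    by (auto simp: modul_op_def mat_of_cols_index length_grp_list basis_vec_def character_def)
  have T: "transl_op m k $$ (c, b) = (if grp_list m ! c = grp_add m (grp_list m ! b) k then 1 else 0)"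
    if "c < prod_list m" for c
    using that assms by (simp add: transl_op_def mat_of_cols_index length_grp_list basis_vec_def)
  have "(modul_op m \<zeta> \<kappa> * transl_op m k) $$ (a, b)
      = (\<Sum>c<prod_list m. modul_op m \<zeta> \<kappa> $$ (a, c) * transl_op m k $$ (c, b))"
    using assms modul_op_carrier[of m \<zeta> \<kappa>] transl_op_carrier[of m k]
    by (auto simp: scalar_prod_def lessThan_atLeast0 intro!: sum.cong)
  also have "\<dots> = (\<Sum>c<prod_list m. if c = a then character m \<zeta> \<kappa> (grp_list m ! a) * transl_op m k $$ (c, b) else 0)"
    by (intro sum.cong) (auto simp: M)
  also have "\<dots> = character m \<zeta> \<kappa> (grp_list m ! a) * transl_op m k $$ (a, b)"
    using assms by simp
  finally show ?thesis using assms by (simp add: T)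
qed

lemma gs_frame_carrier:
  assumes "\<forall>n\<in>set m. odd n"
  shows "gs_frame m \<zeta> (k, \<kappa>) \<in> carrier_vec (card (half m) * prod_list m)"
proof (rule carrier_vecI)
  have "(prod_list m - 1) div 2 = card (half m)" using card_half[OF assms] by simp
  then show "dim_vec (gs_frame m \<zeta> (k, \<kappa>)) = card (half m) * prod_list m"
    using modul_op_carrier[of m \<zeta> \<kappa>] by (simp add: gs_frame_def gs_pi_def kron_def)
qed

text \<open>In block p only the basis element b with b + k = a contributes to coordinate a; this is
  why the argument is shifted back by k.\<close>

lemma gs_frame_index:
  assumes odd: "\<forall>n\<in>set m. odd n" and k: "k \<in> grp m"
    and p: "p < card (half m)" and a: "a < prod_list m"
  shows "gs_frame m \<zeta> (k, \<kappa>) $ (p * prod_list m + a) =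
    character m \<zeta> \<kappa> (grp_list m ! a) * phi_fun m (half_list m ! p) (grp_sub m (grp_list m ! a) k)"
proof -
  let ?N = "prod_list m" and ?g = "\<lambda>a. grp_list m ! a" and ?i = "half_list m ! p"
  let ?B = "modul_op m \<zeta> \<kappa> * transl_op m k"
  have h: "(?N - 1) div 2 = card (half m)" using card_half[OF odd] by simp
  have B: "?B \<in> carrier_mat ?N ?N" using modul_op_carrier transl_op_carrier by (rule mult_carrier_mat)
  have "gs_frame m \<zeta> (k, \<kappa>) $ (p * ?N + a) = (\<Sum>b<?N. ?B $$ (a, b) * psi m $ (p * ?N + b))"
    using kron_one_mult_vec[OF B psi_carrier p a] by (simp only: gs_frame_def gs_pi_def h case_prod_conv)
  also have "\<dots> = (\<Sum>b<?N. (if ?g a = grp_add m (?g b) k then character m \<zeta> \<kappa> (?g a) else 0)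
      * phi_fun m ?i (?g b))"
    using a p by (intro sum.cong) (auto simp: modul_transl_index psi_index)
  also have "\<dots> = (\<Sum>x\<in>grp m. (if ?g a = grp_add m x k then character m \<zeta> \<kappa> (?g a) else 0)
      * phi_fun m ?i x)"
    by (rule sum_grp_list)
  also have "\<dots> = (\<Sum>x\<in>grp m. if x = grp_sub m (?g a) k then character m \<zeta> \<kappa> (?g a) * phi_fun m ?i x else 0)"
  proof (intro sum.cong refl)
    fix x assume x: "x \<in> grp m"
    have "?g a = grp_add m x k \<longleftrightarrow> x = grp_sub m (?g a) k"
      using grp_sub_add[OF x k] grp_add_sub[OF grp_list_nth_in[OF a] k] by metis
    then show "(if ?g a = grp_add m x k then character m \<zeta> \<kappa> (?g a) else 0) * phi_fun m ?i x
      = (if x = grp_sub m (?g a) k then character m \<zeta> \<kappa> (?g a) * phi_fun m ?i x else 0)" by simp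
  qed
  also have "\<dots> = character m \<zeta> \<kappa> (?g a) * phi_fun m ?i (grp_sub m (?g a) k)"
    using finite_grp grp_sub_in[OF grp_list_nth_in[OF a], of k] by simp
  finally show ?thesis .
qed

subsection \<open>Gram matrix and binder of the Gabor-Steiner frame\<close>

locale gabor_steiner =
  fixes m :: "nat list" and \<zeta> :: "nat \<Rightarrow> complex"
  assumes m: "m \<noteq> []" "\<forall>l<length m. odd (m ! l) \<and> 3 \<le> m ! l"
    and \<zeta>: "\<forall>l<length m. primitive_unity_root (m ! l) (\<zeta> l)"
begin

abbreviation "N \<equiv> prod_list m"
abbreviation "f \<equiv> gs_frame m \<zeta>"
abbreviation "\<chi> \<equiv> character m \<zeta>"

lemma odd: "\<forall>n\<in>set m. odd n"
  using m(2) by (metis in_set_conv_nth)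

lemma N_ge_3: "3 \<le> N"
proof -
  obtain n ns where ns: "m = n # ns" using m(1) by (cases m) auto
  have "3 \<le> n" using m(2) ns by force
  moreover have "0 \<notin> set ns" using odd ns by auto
  then have "1 \<le> prod_list ns"
    by (metis One_nat_def Suc_leI gr0I prod_list_zero_iff)
  then have "n \<le> n * prod_list ns" using mult_le_mono2[of 1 "prod_list ns" n] by simp
  ultimately have "3 \<le> n * prod_list ns" by (rule le_trans)
  then show ?thesis by (simp only: ns prod_list.Cons)
qed

lemma gs_dim_eq: "gs_dim m = card (half m) * N"
  unfolding gs_dim_def card_half[OF odd] by simp

lemma norm_\<zeta>: "l < length m \<Longrightarrow> cmod (\<zeta> l) = 1"
proof -
  assume l: "l < length m"
  then have "cmod (\<zeta> l) ^ (m ! l) = 1 ^ (m ! l)"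
    using \<zeta> by (simp add: primitive_unity_root_def flip: norm_power)
  moreover have "0 < m ! l" using m(2) l by force
  ultimately show ?thesis using power_eq_imp_eq_base[of "cmod (\<zeta> l)" "m ! l" 1] by simp
qed

lemma norm_character: "cmod (\<chi> \<kappa> x) = 1"
  by (simp add: character_def norm_\<zeta> norm_power flip: prod_norm)

lemma character_cnj: "\<chi> \<kappa> x * cnj (\<chi> \<kappa> x) = 1"
  using norm_character by (simp add: complex_norm_square[symmetric])

text \<open>The reduction modulo \<open>m ! l\<close> in \<open>grp_add\<close> is absorbed by the
  fact that \<open>\<zeta> l\<close> is an \<open>m ! l\<close>-th root of unity.\<close>

lemma character_add: "\<chi> \<kappa> (grp_add m x e) = \<chi> \<kappa> x * \<chi> \<kappa> e"
  unfolding character_def prod.distrib[symmetric]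
proof (rule prod.cong)
  fix l assume "l \<in> {..<length m}"
  then have l: "l < length m" by simp
  have unity: "\<zeta> l ^ (m ! l) = 1" using \<zeta> l by (simp add: primitive_unity_root_def)
  have "\<zeta> l ^ y = (\<zeta> l ^ (m ! l)) ^ (y div m ! l) * \<zeta> l ^ (y mod m ! l)" for y
    by (metis mult_div_mod_eq power_add power_mult)
  then have mod: "\<zeta> l ^ (y mod m ! l) = \<zeta> l ^ y" for y by (simp add: unity)
  have "\<zeta> l ^ (\<kappa> ! l * grp_add m x e ! l) = (\<zeta> l ^ ((x ! l + e ! l) mod m ! l)) ^ (\<kappa> ! l)"
    using l by (simp add: grp_add_def mult.commute flip: power_mult)
  also have "\<dots> = \<zeta> l ^ (\<kappa> ! l * x ! l) * \<zeta> l ^ (\<kappa> ! l * e ! l)"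
    unfolding mod by (simp add: distrib_left mult.commute add.commute flip: power_mult power_add)
  finally show "\<zeta> l ^ (\<kappa> ! l * grp_add m x e ! l) = \<zeta> l ^ (\<kappa> ! l * x ! l) * \<zeta> l ^ (\<kappa> ! l * e ! l)" .
qed simp

text \<open>Orthogonality of characters by translation: shifting the summation variable by e
  multiplies the sum by \<open>?F e\<close>, which differs from 1, so the sum vanishes.\<close>

lemma sum_character:
  assumes \<kappa>: "\<kappa> \<in> grp m" "\<kappa>' \<in> grp m"
  shows "(\<Sum>x\<in>grp m. \<chi> \<kappa> x * cnj (\<chi> \<kappa>' x)) = (if \<kappa> = \<kappa>' then of_nat N else 0)"
proof (cases "\<kappa> = \<kappa>'")
  case True
  then show ?thesis by (simp add: character_cnj card_grp)
next
  case False
  let ?F = "\<lambda>x. \<chi> \<kappa> x * cnj (\<chi> \<kappa>' x)"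
  have len: "length \<kappa> = length m" "length \<kappa>' = length m" using \<kappa> by (auto simp: grp_def)
  obtain l where l: "l < length m" "\<kappa> ! l \<noteq> \<kappa>' ! l"
    using False len nth_equalityI by metis
  \<comment> \<open>The unit vector at a coordinate where \<kappa> and \<kappa>' differ, so that a
    character at e is a single power of \<open>\<zeta> l\<close>.\<close>
  define e where "e = (replicate (length m) 0)[l := 1 :: nat]"
  have e: "e \<in> grp m"
  proof -
    have "1 < m ! i \<and> 0 < m ! i" if "i < length m" for i using m(2) that by force
    then show ?thesis using l(1) by (auto simp: grp_def e_def nth_list_update)
  qed
  have \<chi>e: "\<chi> \<mu> e = \<zeta> l ^ (\<mu> ! l)" for \<mu>
  proof -
    have "\<chi> \<mu> e = (\<Prod>i<length m. if i = l then \<zeta> l ^ (\<mu> ! l) else 1)"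
      unfolding character_def e_def by (intro prod.cong) (auto simp: nth_list_update)
    then show ?thesis using l(1) by simp
  qed
  \<comment> \<open>Otherwise two distinct powers of \<open>\<zeta> l\<close> with exponents below
    \<open>m ! l\<close> would coincide, against primitivity.\<close>
  have "?F e \<noteq> 1"
  proof
    assume "?F e = 1"
    then have "?F e * \<chi> \<kappa>' e = \<chi> \<kappa>' e" by simp
    then have "\<chi> \<kappa> e * (\<chi> \<kappa>' e * cnj (\<chi> \<kappa>' e)) = \<chi> \<kappa>' e" by (simp add: mult_ac)
    then have "\<chi> \<kappa> e = \<chi> \<kappa>' e" by (simp only: character_cnj mult_1_right)
    then have eq: "\<zeta> l ^ (\<kappa> ! l) = \<zeta> l ^ (\<kappa>' ! l)" by (simp only: \<chi>e)
    have "\<zeta> l \<noteq> 0" using norm_\<zeta>[OF l(1)] by auto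
    then have no: False if "i < j" "j < m ! l" "\<zeta> l ^ i = \<zeta> l ^ j" for i j
    proof -
      have "\<zeta> l ^ i * \<zeta> l ^ (j - i) = \<zeta> l ^ (i + (j - i))" by (simp only: power_add)
      also have "\<dots> = \<zeta> l ^ i * 1" using that by simp
      finally have "\<zeta> l ^ i * \<zeta> l ^ (j - i) = \<zeta> l ^ i * 1" .
      then have "\<zeta> l ^ (j - i) = 1" using \<open>\<zeta> l \<noteq> 0\<close> by simp
      moreover have "0 < j - i" "j - i < m ! l" using that by auto
      ultimately show False using \<zeta> l(1) by (auto simp: primitive_unity_root_def)
    qed
    have "\<kappa> ! l < m ! l" "\<kappa>' ! l < m ! l" using \<kappa> l(1) by (auto simp: grp_def)
    then show False using no[of "\<kappa> ! l" "\<kappa>' ! l"] no[of "\<kappa>' ! l" "\<kappa> ! l"] eq l(2) by (metis linorder_neqE_nat)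
  qed
  moreover have "sum ?F (grp m) * ?F e = sum ?F (grp m)"
  proof -
    have "sum ?F (grp m) * ?F e = (\<Sum>x\<in>grp m. ?F (grp_add m x e))"
      unfolding sum_distrib_right by (intro sum.cong) (simp_all add: character_add mult_ac)
    also have "\<dots> = sum ?F (grp m)"
      by (rule sum.reindex_bij_betw[OF bij_betw_grp_add[OF e]])
    finally show ?thesis .
  qed
  ultimately show ?thesis using False by simp
qed

lemma grp_sub_eq_iff:
  assumes "x \<in> grp m" "k \<in> grp m" "k' \<in> grp m"
  shows "grp_sub m x k = grp_sub m x k' \<longleftrightarrow> k = k'"
proof
  have comm: "grp_add m u v = grp_add m v u" for u v by (simp add: grp_add_def add.commute)
  let ?y = "grp_sub m x k"
  assume "grp_sub m x k = grp_sub m x k'"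
  then have "grp_add m k ?y = grp_add m k' ?y"
    using grp_add_sub[OF assms(1,2)] grp_add_sub[OF assms(1,3)] comm by metis
  then show "k = k'"
    using grp_sub_add[OF assms(2) grp_sub_in[OF assms(1), of k]]
      grp_sub_add[OF assms(3) grp_sub_in[OF assms(1), of k]] by metis
qed simp

text \<open>Summing over the blocks first leaves identity minus reflection, by
  \<open>sum_half_phi_fun\<close>. The identity part survives only for k = k' and is then a
  character sum; the reflection part is supported at the midpoint alone.\<close>

lemma gram:
  assumes k: "k \<in> grp m" "k' \<in> grp m" and \<kappa>: "\<kappa> \<in> grp m" "\<kappa>' \<in> grp m"
  shows "f (k, \<kappa>) \<bullet>c f (k', \<kappa>') = (if k = k' \<and> \<kappa> = \<kappa>' then of_nat N else 0)
    - \<chi> \<kappa> (midpoint m k k') * cnj (\<chi> \<kappa>' (midpoint m k k'))"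
proof -
  let ?g = "\<lambda>a. grp_list m ! a" and ?i = "\<lambda>p. half_list m ! p"
  let ?X = "\<lambda>x. \<chi> \<kappa> x * cnj (\<chi> \<kappa>' x)"
  have cnj_phi: "cnj (phi_fun m i x) = phi_fun m i x" for i x by (simp add: phi_fun_def)
  have "f (k, \<kappa>) \<bullet>c f (k', \<kappa>')
      = (\<Sum>p<card (half m). \<Sum>a<N. f (k, \<kappa>) $ (p * N + a) * cnj (f (k', \<kappa>') $ (p * N + a)))"
    by (simp only: cscalar_prod_sum[OF gs_frame_carrier[OF odd]] sum_lessThan_mult)
  also have "\<dots> = (\<Sum>p<card (half m). \<Sum>a<N. ?X (?g a) *
      (phi_fun m (?i p) (grp_sub m (?g a) k) * phi_fun m (?i p) (grp_sub m (?g a) k')))"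
    by (intro sum.cong refl) (simp add: gs_frame_index[OF odd] k cnj_phi mult_ac)
  also have "\<dots> = (\<Sum>a<N. ?X (?g a) * (\<Sum>p<card (half m).
      phi_fun m (?i p) (grp_sub m (?g a) k) * phi_fun m (?i p) (grp_sub m (?g a) k')))"
    unfolding sum_distrib_left by (rule sum.swap)
  also have "\<dots> = (\<Sum>x\<in>grp m. ?X x * (\<Sum>i\<in>half m. phi_fun m i (grp_sub m x k) * phi_fun m i (grp_sub m x k')))"
    by (simp only: sum_half_list[of "\<lambda>i. phi_fun m i _ * phi_fun m i _"]
        sum_grp_list[of "\<lambda>x. ?X x * (\<Sum>i\<in>half m. phi_fun m i (grp_sub m x k) * phi_fun m i (grp_sub m x k'))"])
  also have "\<dots> = (\<Sum>x\<in>grp m. ?X x * of_bool (k = k') - (if x = midpoint m k k' then ?X x else 0))"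
  proof (intro sum.cong refl)
    fix x assume x: "x \<in> grp m"
    have "grp_sub m x k = reflect m (grp_sub m x k') \<longleftrightarrow> x = midpoint m k k'"
      using midpoint_iff[OF odd k, of x] x by blast
    then show "?X x * (\<Sum>i\<in>half m. phi_fun m i (grp_sub m x k) * phi_fun m i (grp_sub m x k'))
        = ?X x * of_bool (k = k') - (if x = midpoint m k k' then ?X x else 0)"
      unfolding sum_half_phi_fun[OF odd grp_sub_in[OF x] grp_sub_in[OF x]] grp_sub_eq_iff[OF x k]
      by (simp add: right_diff_distrib)
  qed
  also have "\<dots> = (\<Sum>x\<in>grp m. ?X x) * of_bool (k = k') - ?X (midpoint m k k')"
    using midpoint_iff[OF odd k, of "midpoint m k k'"] finite_grp
    by (simp add: sum_subtractf sum_distrib_right)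
  also have "(\<Sum>x\<in>grp m. ?X x) = (if \<kappa> = \<kappa>' then of_nat N else 0)"
    by (rule sum_character[OF \<kappa>])
  finally show ?thesis by auto
qed

lemma frame_carrier: "f p \<in> carrier_vec (gs_dim m)"
  using gs_frame_carrier[OF odd] by (cases p) (simp add: gs_dim_eq)

lemma frame_diag: "p \<in> grp m \<times> grp m \<Longrightarrow> f p \<bullet>c f p = of_nat N - 1"
  by (auto simp: gram character_cnj)

lemma frame_off_diag:
  "p \<in> grp m \<times> grp m \<Longrightarrow> q \<in> grp m \<times> grp m \<Longrightarrow> p \<noteq> q \<Longrightarrow> cmod (f p \<bullet>c f q) = 1"
proof -
  assume pq: "p \<in> grp m \<times> grp m" "q \<in> grp m \<times> grp m" "p \<noteq> q"
  obtain k \<kappa> k' \<kappa>' where p: "p = (k, \<kappa>)" and q: "q = (k', \<kappa>')" by (cases p, cases q) auto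
  have "\<not> (k = k' \<and> \<kappa> = \<kappa>')" using pq(3) p q by blast
  then show ?thesis using pq(1,2) by (simp add: p q gram norm_mult norm_character del: de_Morgan_conj)
qed

lemma binder_simplex_family:
  assumes "\<beta> \<in> gs_binder m \<zeta>"
  shows "\<exists>w. simplex_family (gs_dim m) N \<beta> f w"
proof (rule simplex_imp_simplex_family)
  have \<beta>: "\<beta> \<subseteq> grp m \<times> grp m" "simplex (gs_dim m) f \<beta>"
    using assms by (auto simp: gs_binder_def frame_binder_def)
  then show "simplex (gs_dim m) f \<beta>" by simp
  show "\<forall>j\<in>\<beta>. f j \<bullet>c f j = of_nat N - 1" using frame_diag \<beta>(1) by blast
  show "\<forall>i\<in>\<beta>. \<forall>j\<in>\<beta>. i \<noteq> j \<longrightarrow> cmod (f i \<bullet>c f j) = 1" using frame_off_diag \<beta>(1) by blast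
qed (simp_all add: N_ge_3 frame_carrier)

lemma fiber_in_binder:
  assumes k: "k \<in> grp m"
  shows "{k} \<times> grp m \<in> gs_binder m \<zeta>"
proof -
  \<comment> \<open>All pairs in the fibre share the point \<open>midpoint m k k\<close>, so the
    second term of \<open>gram\<close> factors into these phases.\<close>
  have "simplex_family (gs_dim m) N ({k} \<times> grp m) f (\<lambda>(k, \<kappa>). \<chi> \<kappa> (midpoint m k k))"
    by unfold_locales
      (use k in \<open>auto simp: finite_grp card_grp card_cartesian_product N_ge_3 frame_carrier norm_character gram\<close>)
  then have "simplex (gs_dim m) f ({k} \<times> grp m)" by (rule simplex_family.simplex)
  then show ?thesis using k by (auto simp: gs_binder_def frame_binder_def)
qed

lemma partition_exists: "\<exists>\<A> \<subseteq> gs_binder m \<zeta>. partition_on (grp m \<times> grp m) \<A>"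
proof (intro exI conjI)
  show "(\<lambda>k. {k} \<times> grp m) ` grp m \<subseteq> gs_binder m \<zeta>" using fiber_in_binder by auto
  show "partition_on (grp m \<times> grp m) ((\<lambda>k. {k} \<times> grp m) ` grp m)"
    by (rule partition_onI) (auto simp: disjnt_def)
qed

lemma proj_eq:
  assumes "simplex_family (gs_dim m) N \<beta> f w"
  shows "gs_proj m \<zeta> \<beta> = (1 / of_nat N) \<cdot>\<^sub>m frame_op (gs_dim m) \<beta> f"
  unfolding gs_proj_def gs_space_def by (rule simplex_family.orth_proj_S[OF assms])

lemma proj_carrier:
  assumes "\<beta> \<in> gs_binder m \<zeta>"
  shows "gs_proj m \<zeta> \<beta> \<in> carrier_mat (gs_dim m) (gs_dim m)"
proof -
  obtain w where "simplex_family (gs_dim m) N \<beta> f w" using binder_simplex_family[OF assms] by blast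
  then show ?thesis by (simp only: proj_eq smult_carrier_mat frame_op_carrier)
qed

lemma trace_proj:
  assumes "\<beta> \<in> gs_binder m \<zeta>"
  shows "trace (gs_proj m \<zeta> \<beta>) = of_nat N - 1"
proof -
  obtain w where w: "simplex_family (gs_dim m) N \<beta> f w" using binder_simplex_family[OF assms] by blast
  show ?thesis unfolding proj_eq[OF w] by (rule simplex_family.trace_P[OF w])
qed

lemma trace_proj_proj:
  assumes "\<beta> \<in> gs_binder m \<zeta>"
  shows "trace (gs_proj m \<zeta> \<beta> * gs_proj m \<zeta> \<beta>) = of_nat N - 1"
proof -
  obtain w where w: "simplex_family (gs_dim m) N \<beta> f w" using binder_simplex_family[OF assms] by blast
  show ?thesis unfolding proj_eq[OF w] by (rule simplex_family.trace_P_P[OF w])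
qed

lemma gs_state_eq: "\<beta> \<in> gs_binder m \<zeta> \<Longrightarrow> gs_state m \<zeta> \<beta> = of_real (1 / (real N - 1)) \<cdot>\<^sub>m gs_proj m \<zeta> \<beta>"
  by (simp add: gs_state_def trace_proj)

lemma pos_semidef_scaled_proj:
  assumes "\<beta> \<in> gs_binder m \<zeta>" "0 \<le> c"
  shows "pos_semidef (gs_dim m) (of_real c \<cdot>\<^sub>m gs_proj m \<zeta> \<beta>)"
proof -
  obtain w where w: "simplex_family (gs_dim m) N \<beta> f w" using binder_simplex_family[OF assms(1)] by blast
  show ?thesis unfolding proj_eq[OF w] by (rule simplex_family.pos_semidef_P[OF w assms(2)])
qed

lemma proj_adjoint:
  assumes "\<beta> \<in> gs_binder m \<zeta>"
  shows "mat_adjoint (gs_proj m \<zeta> \<beta>) = gs_proj m \<zeta> \<beta>"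
proof -
  have "of_real 1 \<cdot>\<^sub>m gs_proj m \<zeta> \<beta> = gs_proj m \<zeta> \<beta>" by (rule eq_matI) auto
  then show ?thesis using pos_semidef_scaled_proj[OF assms, of 1] by (simp add: pos_semidef_def)
qed

lemma trace_state_mult:
  assumes "\<beta> \<in> gs_binder m \<zeta>" "\<beta>' \<in> gs_binder m \<zeta>"
  shows "trace (gs_state m \<zeta> \<beta> * gs_state m \<zeta> \<beta>')
    = of_real (1 / (real N - 1) * (1 / (real N - 1))) * trace (gs_proj m \<zeta> \<beta> * gs_proj m \<zeta> \<beta>')"
  unfolding gs_state_eq[OF assms(1)] gs_state_eq[OF assms(2)] of_real_mult
  by (rule trace_smult_mult[OF proj_carrier[OF assms(1)] proj_carrier[OF assms(2)]])

lemma trace_proj_disjoint: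
  assumes "\<beta> \<in> gs_binder m \<zeta>" "\<beta>' \<in> gs_binder m \<zeta>" "\<beta> \<inter> \<beta>' = {}"
  shows "trace (gs_proj m \<zeta> \<beta> * gs_proj m \<zeta> \<beta>') = 1"
proof -
  obtain w where w: "simplex_family (gs_dim m) N \<beta> f w" using binder_simplex_family[OF assms(1)] by blast
  obtain w' where w': "simplex_family (gs_dim m) N \<beta>' f w'" using binder_simplex_family[OF assms(2)] by blast
  have "\<beta> \<subseteq> grp m \<times> grp m" "\<beta>' \<subseteq> grp m \<times> grp m"
    using assms by (auto simp: gs_binder_def frame_binder_def)
  then have "cmod (f p \<bullet>c f q) = 1" if "p \<in> \<beta>" "q \<in> \<beta>'" for p q
    using frame_off_diag[of p q] assms(3) that by blast
  then have "\<forall>p\<in>\<beta>. \<forall>q\<in>\<beta>'. cmod (f p \<bullet>c f q) = 1" by simp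
  then show ?thesis
    unfolding gs_proj_def gs_space_def by (rule trace_proj_mult[OF w w'])
qed

text \<open>Counting: the N^2 points of G x G are divided into blocks of N points each.\<close>

lemma card_partition_binder:
  assumes "\<A> \<subseteq> gs_binder m \<zeta>" "partition_on (grp m \<times> grp m) \<A>"
  shows "card \<A> = N"
proof -
  have U: "grp m \<times> grp m = \<Union>\<A>" by (rule partition_onD1[OF assms(2)])
  have \<A>: "card \<beta> = N" "finite \<beta>" if "\<beta> \<in> \<A>" for \<beta>
    using binder_simplex_family assms(1) that simplex_family.card_J simplex_family.fin by blast+
  have "N * N = card (grp m \<times> grp m)" by (simp add: card_cartesian_product card_grp)
  also have "\<dots> = sum card \<A>"
    unfolding U by (rule card_Union_disjoint[OF partition_onD2[OF assms(2)] \<A>(2)])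
  also have "\<dots> = card \<A> * N" using \<A>(1) by simp
  finally have "N * N = card \<A> * N" .
  moreover have "N \<noteq> 0" using N_ge_3 by linarith
  ultimately show ?thesis by (metis mult_right_cancel)
qed

end

section \<open>States, the Rankin value and chordal distances\<close>

lemma trace_diff_mult:
  assumes "A \<in> carrier_mat d d" "B \<in> carrier_mat d d"
  shows "trace ((A - B) * (A - B)) = trace (A * A) - trace (A * B) - trace (B * A) + trace (B * B)"
proof -
  have diff: "trace (C - D) = trace C - trace D" if "C \<in> carrier_mat d d" "D \<in> carrier_mat d d" for C D
    using that by (simp add: trace_def sum_subtractf)
  have "(A - B) * (A - B) = (A * A - A * B) - (B * A - B * B)"
    using minus_mult_distrib_mat[OF assms minus_carrier_mat[OF assms(2), of A]]
      mult_minus_distrib_mat[OF assms(1,1,2)] mult_minus_distrib_mat[OF assms(2,1,2)] by simp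
  then show ?thesis
    using assms by (simp add: diff minus_carrier_mat)
qed

theorem theorem6p2:
  fixes m :: "nat list" and \<zeta> :: "nat \<Rightarrow> complex"
  assumes "m \<noteq> []"
    and "\<forall>l<length m. odd (m ! l) \<and> 3 \<le> m ! l"
    and "\<forall>l<length m. primitive_unity_root (m ! l) (\<zeta> l)"
  shows "(\<exists>\<A> \<subseteq> gs_binder m \<zeta>. partition_on (grp m \<times> grp m) \<A>) \<and>
    (\<forall>\<A> \<subseteq> gs_binder m \<zeta>. partition_on (grp m \<times> grp m) \<A> \<longrightarrow>
      (\<forall>\<beta>\<in>\<A>. \<forall>\<beta>'\<in>\<A>. \<beta> \<noteq> \<beta>' \<longrightarrow> trace (gs_proj m \<zeta> \<beta> * gs_proj m \<zeta> \<beta>') = 1) \<and>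
      card \<A> = prod_list m \<and>
      inj_on (gs_state m \<zeta>) \<A> \<and>
      (\<forall>\<beta>\<in>\<A>. pos_semidef (gs_dim m) (gs_state m \<zeta> \<beta>) \<and>
        trace (gs_state m \<zeta> \<beta>) = 1 \<and>
        trace (gs_state m \<zeta> \<beta> * gs_state m \<zeta> \<beta>) = of_real (1 / (real (prod_list m) - 1))) \<and>
      (\<forall>\<beta>\<in>\<A>. \<forall>\<beta>'\<in>\<A>. \<beta> \<noteq> \<beta>' \<longrightarrow>
        (let n = real (prod_list m); d = n * (n - 1) / 2; \<gamma> = 1 / (n - 1) in
          trace (gs_state m \<zeta> \<beta> * gs_state m \<zeta> \<beta>') = of_real ((n - \<gamma> * d) / ((n - 1) * d)))) \<and>
      card (gs_space m \<zeta> ` \<A>) = prod_list m \<and>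
      equichordal (gs_dim m) (prod_list m - 1) (gs_space m \<zeta> ` \<A>))"
proof (intro conjI allI impI)
  interpret gabor_steiner m \<zeta> using assms by unfold_locales
  show "\<exists>\<A> \<subseteq> gs_binder m \<zeta>. partition_on (grp m \<times> grp m) \<A>"
    by (rule partition_exists)
  fix \<A> assume sub: "\<A> \<subseteq> gs_binder m \<zeta>" and part: "partition_on (grp m \<times> grp m) \<A>"
  define n where "n = real N"
  have n: "3 \<le> n" using N_ge_3 by (simp add: n_def)
  have B: "\<beta> \<in> gs_binder m \<zeta>" if "\<beta> \<in> \<A>" for \<beta> using sub that by blast
  have tr1: "trace (gs_proj m \<zeta> \<beta> * gs_proj m \<zeta> \<beta>') = 1" if "\<beta> \<in> \<A>" "\<beta>' \<in> \<A>" "\<beta> \<noteq> \<beta>'" for \<beta> \<beta>'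
    using trace_proj_disjoint B that part by (meson partition_onD2 disjointD)
  show "\<forall>\<beta>\<in>\<A>. \<forall>\<beta>'\<in>\<A>. \<beta> \<noteq> \<beta>' \<longrightarrow> trace (gs_proj m \<zeta> \<beta> * gs_proj m \<zeta> \<beta>') = 1"
    using tr1 by blast
  show card: "card \<A> = N" by (rule card_partition_binder[OF sub part])
  have same: "trace (gs_state m \<zeta> \<beta> * gs_state m \<zeta> \<beta>) = of_real (1 / (n - 1))" if "\<beta> \<in> \<A>" for \<beta>
  proof -
    have "(of_nat N - 1 :: complex) = of_real (n - 1)" by (simp add: n_def)
    then have "trace (gs_state m \<zeta> \<beta> * gs_state m \<zeta> \<beta>) = of_real (1 / (n - 1) * (1 / (n - 1)) * (n - 1))"
      using trace_state_mult trace_proj_proj B that by (simp only: of_real_mult n_def)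
    then show ?thesis using n by simp
  qed
  have cross: "trace (gs_state m \<zeta> \<beta> * gs_state m \<zeta> \<beta>') = of_real (1 / (n - 1) * (1 / (n - 1)))"
    if "\<beta> \<in> \<A>" "\<beta>' \<in> \<A>" "\<beta> \<noteq> \<beta>'" for \<beta> \<beta>'
    unfolding trace_state_mult[OF B[OF that(1)] B[OF that(2)]] tr1[OF that] n_def by (rule mult_1_right)
  \<comment> \<open>Equal states would have equal purity and cross trace, but 1/(n - 1) and its
    square differ because n >= 3.\<close>
  have inj: "inj_on (gs_state m \<zeta>) \<A>"
  proof (rule inj_onI, rule ccontr)
    fix \<beta> \<beta>' assume \<beta>: "\<beta> \<in> \<A>" "\<beta>' \<in> \<A>" "gs_state m \<zeta> \<beta> = gs_state m \<zeta> \<beta>'" "\<beta> \<noteq> \<beta>'"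
    then have "of_real (1 / (n - 1)) = (of_real (1 / (n - 1) * (1 / (n - 1))) :: complex)"
      using same[of \<beta>] cross[of \<beta> \<beta>'] by simp
    then have "1 / (n - 1) = 1 / (n - 1) * (1 / (n - 1))" by (simp only: of_real_eq_iff)
    moreover obtain t where t: "n - 1 = t" by blast
    ultimately have "t = 1" using n by (simp add: field_simps)
    then show False using n t by simp
  qed
  then show "inj_on (gs_state m \<zeta>) \<A>" .
  show "\<forall>\<beta>\<in>\<A>. pos_semidef (gs_dim m) (gs_state m \<zeta> \<beta>) \<and>
        trace (gs_state m \<zeta> \<beta>) = 1 \<and>
        trace (gs_state m \<zeta> \<beta> * gs_state m \<zeta> \<beta>) = of_real (1 / (real N - 1))"
  proof (intro ballI conjI)
    fix \<beta> assume \<beta>: "\<beta> \<in> \<A>"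
    show "pos_semidef (gs_dim m) (gs_state m \<zeta> \<beta>)"
      unfolding gs_state_eq[OF B[OF \<beta>]] by (rule pos_semidef_scaled_proj[OF B[OF \<beta>]]) (use n in \<open>simp add: n_def\<close>)
    have "(of_nat N - 1 :: complex) = of_real (n - 1)" by (simp add: n_def)
    then have "trace (gs_state m \<zeta> \<beta>) = of_real (1 / (n - 1) * (n - 1))"
      using trace_smult[OF proj_carrier[OF B[OF \<beta>]]] trace_proj[OF B[OF \<beta>]]
      by (simp only: gs_state_eq[OF B[OF \<beta>]] of_real_mult n_def)
    then show "trace (gs_state m \<zeta> \<beta>) = 1" using n by simp
    show "trace (gs_state m \<zeta> \<beta> * gs_state m \<zeta> \<beta>) = of_real (1 / (real N - 1))"
      using same[OF \<beta>] by (simp only: n_def)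
  qed
  \<comment> \<open>Here \<gamma> d = n/2, so the numerator is n/2 and the denominator is (n/2)(n -
    1)^2.\<close>
  have rankin: "(n - 1 / (n - 1) * (n * (n - 1) / 2)) / ((n - 1) * (n * (n - 1) / 2)) = 1 / (n - 1) * (1 / (n - 1))"
    using n by (simp add: divide_simps)
  show "\<forall>\<beta>\<in>\<A>. \<forall>\<beta>'\<in>\<A>. \<beta> \<noteq> \<beta>' \<longrightarrow>
        (let n = real N; d = n * (n - 1) / 2; \<gamma> = 1 / (n - 1) in
          trace (gs_state m \<zeta> \<beta> * gs_state m \<zeta> \<beta>') = of_real ((n - \<gamma> * d) / ((n - 1) * d)))"
    unfolding Let_def n_def[symmetric] rankin using cross by blast
  \<comment> \<open>A state depends on its index only through the space, so distinct states have
    distinct spaces.\<close>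
  have "inj_on (gs_space m \<zeta>) \<A>"
    using inj unfolding inj_on_def gs_state_def gs_proj_def by metis
  then show "card (gs_space m \<zeta> ` \<A>) = N" using card card_image by metis
  show "equichordal (gs_dim m) (N - 1) (gs_space m \<zeta> ` \<A>)"
    unfolding equichordal_def
  \<comment> \<open>The squared chordal distance is the dimension n - 1 minus the trace 1 of the
    product of the projections.\<close>
  proof (intro conjI exI[of _ "sqrt (n - 2)"] ballI impI)
    fix S assume "S \<in> gs_space m \<zeta> ` \<A>"
    then obtain \<beta> where \<beta>: "\<beta> \<in> \<A>" and S: "S = gs_space m \<zeta> \<beta>" by blast
    obtain w where w: "simplex_family (gs_dim m) N \<beta> f w" using binder_simplex_family[OF B[OF \<beta>]] by blast
    show "lsubspace (gs_dim m) S" "ldim (gs_dim m) S = N - 1"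
      using simplex_family.lsubspace_S[OF w] simplex_family.ldim_S[OF w] by (simp_all add: S gs_space_def)
    fix S' assume "S' \<in> gs_space m \<zeta> ` \<A>" "S \<noteq> S'"
    then obtain \<beta>' where \<beta>': "\<beta>' \<in> \<A>" "\<beta> \<noteq> \<beta>'" and S': "S' = gs_space m \<zeta> \<beta>'" using S by blast
    let ?P = "gs_proj m \<zeta> \<beta>" and ?Q = "gs_proj m \<zeta> \<beta>'"
    have PQ: "?P \<in> carrier_mat (gs_dim m) (gs_dim m)" "?Q \<in> carrier_mat (gs_dim m) (gs_dim m)"
      using proj_carrier B \<beta> \<beta>' by auto
    have "mat_adjoint (?P - ?Q) = mat_adjoint ?P - mat_adjoint ?Q"
      using PQ by (intro eq_matI) (auto simp: mat_adjoint_def mat_of_rows_def)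
    then have adj: "mat_adjoint (?P - ?Q) = ?P - ?Q" using proj_adjoint B \<beta> \<beta>' by simp
    have "trace ((?P - ?Q) * mat_adjoint (?P - ?Q)) = of_real (2 * (n - 2))"
      unfolding adj trace_diff_mult[OF PQ]
      using tr1[OF \<beta> \<beta>'] tr1[OF \<beta>'(1) \<beta>] \<beta>'(2) trace_proj_proj B \<beta> \<beta>' by (simp add: n_def)
    then show "chordal_dist (gs_dim m) S S' = sqrt (n - 2)"
      by (simp add: chordal_dist_def Let_def S S' flip: gs_proj_def)
  qed
qed

end
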